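(* Let $*$ and $\bullet$ be continuous t-norms on $[0,1]$. Then $([0,1],* )\cong_t([0,1],\bullet)$ if and only if there is an order isomorphism $\Phi\colon(\Upsilon( * ),\prec)\to(\Upsilon(\bullet),\prec)$ such that for every $(a,b)\in\Upsilon( * )$ and every $i\in\{P,\text{Ł},M\}$, $(a,b)\in\mathcal{I}_i^*\iff\Phi(a,b)\in\mathcal{I}_i^{\bullet}$.
   Context: For real $a<b$, a continuous t-norm on $[a,b]$ is a continuous map $*\colon[a,b]^2\to[a,b]$ such that $([a,b],*,b)$ is a commutative monoid and $*$ is monotone in each argument; continuous t-norms $([a_1,b_1],*_1)$ and $([a_2,b_2],*_2)$ are isomorphic ($\cong_t$) if there is an order isomorphism $\phi\colon[a_1,b_1]\to[a_2,b_2]$ with $\phi(x*_1y)=\phi(x)*_2\phi(y)$. The product t-norm is $p*_Pq=pq$ and the Łukasiewicz t-norm is $p*_{\text{Ł}}q=\max\{0,p+q-1\}$ on $[0,1]$. An element $q$ is idempotent for $*$ if $q*q=q$. For a continuous t-norm $*$ on $[0,1]$, the set of non-idempotent elements is a union of countably many pairwise disjoint open intervals $(a,b)$ (its connected components), and for each such component the restriction of $*$ to $[a,b]$ is a continuous t-norm on $[a,b]$ isomorphic to either the product or the Łukasiewicz t-norm. Let $\mathcal{I}_P^*$ (resp. $\mathcal{I}_{\text{Ł}}^*$) be the set of these components $(a,b)$ for which $([a,b],* )$ is isomorphic to $([0,1],*_P)$ (resp. $([0,1],*_{\text{Ł}})$), and let $\mathcal{I}_M^*$ be the set of maximal (under inclusion)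 nonempty open intervals $(a,b)$, $0\le a<b\le 1$, all of whose elements are idempotent for $*$. Put $\Upsilon( * )=\mathcal{I}_P^*\cup\mathcal{I}_{\text{Ł}}^*\cup\mathcal{I}_M^*$, a family of pairwise disjoint open intervals, linearly ordered by $(a,b)\prec(c,d)\iff b\le c$. *)

theory Defs
  imports "HOL-Analysis.Analysis"
begin

text \<open>
  Operations on $[a,b]$ are total functions on the reals; only their values on $[a,b]^2$ matter.
\<close>

definition continuous_tnorm :: "real \<Rightarrow> real \<Rightarrow> (real \<Rightarrow> real \<Rightarrow> real) \<Rightarrow> bool" where
  "continuous_tnorm a b T \<longleftrightarrow>
     a < b \<and>
     (\<forall>x\<in>{a..b}. \<forall>y\<in>{a..b}. T x y \<in> {a..b}) \<and>
     (\<forall>x\<in>{a..b}. \<forall>y\<in>{a..b}. \<forall>z\<in>{a..b}. T (T x y) z = T x (T y z)) \<and>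
     (\<forall>x\<in>{a..b}. \<forall>y\<in>{a..b}. T x y = T y x) \<and>
     (\<forall>x\<in>{a..b}. T x b = x \<and> T b x = x) \<and>
     (\<forall>x\<in>{a..b}. mono_on {a..b} (\<lambda>y. T x y) \<and> mono_on {a..b} (\<lambda>y. T y x)) \<and>
     continuous_on ({a..b} \<times> {a..b}) (\<lambda>(x, y). T x y)"

definition order_iso_between ::
    "'a set \<Rightarrow> ('a \<Rightarrow> 'a \<Rightarrow> bool) \<Rightarrow> 'b set \<Rightarrow> ('b \<Rightarrow> 'b \<Rightarrow> bool) \<Rightarrow> ('a \<Rightarrow> 'b) \<Rightarrow> bool" where
  "order_iso_between A R B S f \<longleftrightarrow>
     bij_betw f A B \<and> (\<forall>x\<in>A. \<forall>y\<in>A. R x y \<longleftrightarrow> S (f x) (f y))"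

text \<open>
  Isomorphism is a relation between continuous t-norms. Applied to an operation on a larger
  interval, it therefore also says that the restriction to $[a_1,b_1]$ (resp. $[a_2,b_2]$) is a
  continuous t-norm.
\<close>

definition tnorm_isomorphic ::
    "real \<Rightarrow> real \<Rightarrow> (real \<Rightarrow> real \<Rightarrow> real) \<Rightarrow> real \<Rightarrow> real \<Rightarrow> (real \<Rightarrow> real \<Rightarrow> real) \<Rightarrow> bool" where
  "tnorm_isomorphic a1 b1 T1 a2 b2 T2 \<longleftrightarrow>
     continuous_tnorm a1 b1 T1 \<and> continuous_tnorm a2 b2 T2 \<and>
     (\<exists>\<phi>. order_iso_between {a1..b1} (\<le>) {a2..b2} (\<le>) \<phi> \<and>
          (\<forall>x\<in>{a1..b1}. \<forall>y\<in>{a1..b1}. \<phi> (T1 x y) = T2 (\<phi> x) (\<phi> y)))"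

definition product_tnorm :: "real \<Rightarrow> real \<Rightarrow> real" where
  "product_tnorm p q = p * q"

definition lukasiewicz_tnorm :: "real \<Rightarrow> real \<Rightarrow> real" where
  "lukasiewicz_tnorm p q = max 0 (p + q - 1)"

definition non_idempotents :: "(real \<Rightarrow> real \<Rightarrow> real) \<Rightarrow> real set" where
  "non_idempotents T = {q \<in> {0..1}. T q q \<noteq> q}"

definition idempotent_interval :: "(real \<Rightarrow> real \<Rightarrow> real) \<Rightarrow> real \<Rightarrow> real \<Rightarrow> bool" where
  "idempotent_interval T a b \<longleftrightarrow> 0 \<le> a \<and> a < b \<and> b \<le> 1 \<and> (\<forall>q\<in>{a<..<b}. T q q = q)"

datatype interval_kind = Product | Lukasiewicz | Minimum

text \<open>
  An open interval is represented by the pair of its endpoints.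
\<close>

fun intervals_of_kind :: "interval_kind \<Rightarrow> (real \<Rightarrow> real \<Rightarrow> real) \<Rightarrow> (real \<times> real) set" where
  "intervals_of_kind Product T =
     {(a, b). {a<..<b} \<in> components (non_idempotents T) \<and>
              tnorm_isomorphic a b T 0 1 product_tnorm}"
| "intervals_of_kind Lukasiewicz T =
     {(a, b). {a<..<b} \<in> components (non_idempotents T) \<and>
              tnorm_isomorphic a b T 0 1 lukasiewicz_tnorm}"
| "intervals_of_kind Minimum T =
     {(a, b). idempotent_interval T a b \<and>
              (\<forall>c d. idempotent_interval T c d \<and> {a<..<b} \<subseteq> {c<..<d} \<longrightarrow> {c<..<d} = {a<..<b})}"

definition Upsilon :: "(real \<Rightarrow> real \<Rightarrow> real) \<Rightarrow> (real \<times> real) set" where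
  "Upsilon T =
     intervals_of_kind Product T \<union> intervals_of_kind Lukasiewicz T \<union> intervals_of_kind Minimum T"

definition interval_prec :: "real \<times> real \<Rightarrow> real \<times> real \<Rightarrow> bool"  (infix "\<prec>" 50) where
  "I \<prec> J \<longleftrightarrow> snd I \<le> fst J"

lemma continuous_tnorm_product: "continuous_tnorm 0 1 product_tnorm"
  unfolding continuous_tnorm_def product_tnorm_def
  by (auto simp: mult_le_one mono_on_def mult_left_mono mult_right_mono case_prod_unfold
      intro!: continuous_intros)

lemma continuous_tnorm_lukasiewicz: "continuous_tnorm 0 1 lukasiewicz_tnorm"
proof -
  have "continuous_on ({0..1} \<times> {0..1}) (\<lambda>(x, y). lukasiewicz_tnorm x y)"
    unfolding lukasiewicz_tnorm_def case_prod_unfold by (intro continuous_intros)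
  then show ?thesis
    unfolding continuous_tnorm_def
    by (intro conjI; (assumption | auto simp: lukasiewicz_tnorm_def mono_on_def max_def))
qed

end

theory Submission
  imports Defs
begin

text \<open>
  A continuous t-norm acts as the minimum on any two points separated by an idempotent, so it is
  determined by its restrictions to the components of the non-idempotent set. Each of them is
  isomorphic to the product or the Lukasiewicz t-norm (Mostert--Shields): iterated square roots
  of an interior point yield a one-parameter semigroup $t \mapsto g(t)$ with
  $g(s+t) = g(s) * g(t)$, and reading $t$ as $-\ln p$ when $g$ never reaches the bottom, or as a
  multiple of $1-p$ when it does, turns $*$ into one of the two models. An isomorphism of t-norms
  transports the interval families. Conversely, the intervals of $\Upsilon$ have a dense union, so
  isomorphisms chosen interval by interval glue to an order isomorphism between dense subsets of
  $[0,1]$, which extends to $[0,1]$ by suprema and respects idempotents.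
\<close>

section \<open>Continuous t-norms on an interval\<close>

text \<open>The idempotents can form a Cantor-like set, most of whose points lie in no closed
  interval of \<open>Upsilon\<close>. A map therefore cannot be defined piece by piece, which forces
  the extension from a dense set; density of the image then gives surjectivity without any
  continuity argument. For the homomorphism law it suffices that idempotents go to idempotents: if
  \<open>[x, y]\<close> contains an idempotent, both operations act as the minimum, and otherwise
  \<open>x\<close> and \<open>y\<close> lie in one component, where the local isomorphism applies.
  Inside a component all convergence comes from one principle: a limit of points whose squares have
  the same limit is idempotent, hence an endpoint. The semigroup may reach the bottom in finite time
  and stay there, so \<open>gen\<close> need not be injective; the models are therefore mapped into
  \<open>[a, b]\<close> through \<open>gen\<close>, and the isomorphism is inverted
  afterwards.\<close>

locale tnorm_interval =
  fixes a b :: real and S :: "real \<Rightarrow> real \<Rightarrow> real"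
  assumes tnorm: "continuous_tnorm a b S"
begin

lemma less: "a < b"
  using tnorm by (simp add: continuous_tnorm_def)

lemma closed: "x \<in> {a..b} \<Longrightarrow> y \<in> {a..b} \<Longrightarrow> S x y \<in> {a..b}"
  using tnorm unfolding continuous_tnorm_def by blast

lemma assoc: "x \<in> {a..b} \<Longrightarrow> y \<in> {a..b} \<Longrightarrow> z \<in> {a..b} \<Longrightarrow> S (S x y) z = S x (S y z)"
  using tnorm unfolding continuous_tnorm_def by blast

lemma comm: "x \<in> {a..b} \<Longrightarrow> y \<in> {a..b} \<Longrightarrow> S x y = S y x"
  using tnorm unfolding continuous_tnorm_def by blast

lemma unit: "x \<in> {a..b} \<Longrightarrow> S x b = x" "x \<in> {a..b} \<Longrightarrow> S b x = x"
  using tnorm unfolding continuous_tnorm_def by blast+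

lemma mono:
  assumes "x \<le> x'" "y \<le> y'" "x \<in> {a..b}" "y \<in> {a..b}" "x' \<in> {a..b}" "y' \<in> {a..b}"
  shows "S x y \<le> S x' y'"
proof -
  have "mono_on {a..b} (\<lambda>y. S x y)" "mono_on {a..b} (\<lambda>x. S x y')"
    using tnorm assms unfolding continuous_tnorm_def by blast+
  then have "S x y \<le> S x y'" "S x y' \<le> S x' y'"
    using mono_onD[of "{a..b}" "S x"] mono_onD[of "{a..b}" "\<lambda>x. S x y'"] assms by auto
  then show ?thesis by simp
qed

lemma le_left: "x \<in> {a..b} \<Longrightarrow> y \<in> {a..b} \<Longrightarrow> S x y \<le> x"
  using mono[of x x y b] unit(1)[of x] less by auto

lemma le_right: "x \<in> {a..b} \<Longrightarrow> y \<in> {a..b} \<Longrightarrow> S x y \<le> y"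
  using le_left comm by metis

lemma bot: "x \<in> {a..b} \<Longrightarrow> S x a = a" "x \<in> {a..b} \<Longrightarrow> S a x = a"
  using le_right[of x a] le_left[of a x] closed[of x a] closed[of a x] less by auto

lemma continuous: "continuous_on ({a..b} \<times> {a..b}) (\<lambda>(x, y). S x y)"
  using tnorm unfolding continuous_tnorm_def by blast

lemma continuous_compose:
  assumes "continuous_on A f" "continuous_on A g" "f ` A \<subseteq> {a..b}" "g ` A \<subseteq> {a..b}"
  shows "continuous_on A (\<lambda>x. S (f x) (g x))"
  using continuous_on_compose2[OF continuous continuous_on_Pair[OF assms(1,2)]] assms(3,4) by auto

lemma tendsto:
  assumes X: "X \<longlonglongrightarrow> x" and Y: "Y \<longlonglongrightarrow> y"
    and mem: "\<And>n. X n \<in> {a..b}" "\<And>n. Y n \<in> {a..b}"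
  shows "(\<lambda>n. S (X n) (Y n)) \<longlonglongrightarrow> S x y"
proof -
  have "x \<in> {a..b}" "y \<in> {a..b}"
    using closed_sequentially[OF closed_atLeastAtMost] mem X Y by blast+
  moreover have "(\<lambda>n. (X n, Y n)) \<longlonglongrightarrow> (x, y)"
    using X Y by (rule tendsto_Pair)
  ultimately show ?thesis
    using continuous_on_tendsto_compose[OF continuous, of "\<lambda>n. (X n, Y n)" "(x, y)" sequentially] mem
    by auto
qed

lemma square_root:
  assumes "x \<in> {a..b}" shows "\<exists>y\<in>{a..b}. S y y = x"
proof -
  have "continuous_on {a..b} (\<lambda>y. S y y)"
    by (rule continuous_compose) (auto intro: continuous_on_id)
  moreover have "S a a = a" "S b b = b"
    using bot unit less by auto
  ultimately show ?thesis
    using IVT'[of "\<lambda>y. S y y" a x b] assms less by auto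
qed

text \<open>By the intermediate value theorem every \<open>x\<close> below \<open>e\<close> has the
  form \<open>S t e\<close>, and a second factor \<open>e\<close> changes nothing.\<close>

lemma idem_absorb:
  assumes e: "S e e = e" "e \<in> {a..b}" and x: "x \<in> {a..e}"
  shows "S x e = x"
proof -
  have "continuous_on {a..b} (\<lambda>t. S t e)"
    using e by (intro continuous_compose) auto
  moreover have "S a e = a" "S b e = e"
    using bot unit e by auto
  ultimately obtain t where t: "t \<in> {a..b}" "S t e = x"
    using IVT'[of "\<lambda>t. S t e" a x b] x less by auto
  then show ?thesis
    using assoc[of t e e] e by simp
qed

text \<open>Squeeze: \<open>x = S x e <= S x y <= x\<close>.\<close>

lemma idem_between:
  assumes "S e e = e" "a \<le> x" "x \<le> e" "e \<le> y" "y \<le> b"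
  shows "S x y = x"
proof -
  have "S x e = x" using idem_absorb assms by auto
  moreover have "S x e \<le> S x y" using assms by (intro mono) auto
  moreover have "S x y \<le> x" using le_left assms by auto
  ultimately show ?thesis by simp
qed

text \<open>Idempotence of \<open>c\<close> keeps products above \<open>c\<close>; idempotence of
  \<open>d\<close> makes \<open>d\<close> the unit, by \<open>idem_absorb\<close>.\<close>

lemma restrict:
  assumes c: "S c c = c" and d: "S d d = d" and "a \<le> c" "c < d" "d \<le> b"
  shows "continuous_tnorm c d S"
proof -
  have sub: "{c..d} \<subseteq> {a..b}" using assms by auto
  have closed': "S x y \<in> {c..d}" if "x \<in> {c..d}" "y \<in> {c..d}" for x y
    using mono[of c x c y] mono[of x d y d] that sub c d \<open>c < d\<close> by auto
  have unit': "S x d = x" "S d x = x" if "x \<in> {c..d}" for x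
    using idem_absorb[of d x] comm[of x d] d that sub \<open>c < d\<close> by auto
  have assoc': "S (S x y) z = S x (S y z)" if "x \<in> {c..d}" "y \<in> {c..d}" "z \<in> {c..d}" for x y z
    using assoc that sub by blast
  have comm': "S x y = S y x" if "x \<in> {c..d}" "y \<in> {c..d}" for x y
    using comm that sub by blast
  have mono': "mono_on {c..d} (\<lambda>y. S x y)" "mono_on {c..d} (\<lambda>y. S y x)" if "x \<in> {c..d}" for x
    using that sub by (auto intro!: mono_onI mono)
  have cont: "continuous_on ({c..d} \<times> {c..d}) (\<lambda>(x, y). S x y)"
    using continuous by (rule continuous_on_subset) (use sub in auto)
  show ?thesis
    unfolding continuous_tnorm_def
    by (intro conjI ballI closed' unit' assoc' comm' mono' cont \<open>c < d\<close>)
qed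

section \<open>Powers with natural exponents\<close>

definition pow :: "real \<Rightarrow> nat \<Rightarrow> real" where
  "pow x k = (S x ^^ k) b"

lemma pow_0 [simp]: "pow x 0 = b"
  by (simp add: pow_def)

lemma pow_Suc: "pow x (Suc k) = S x (pow x k)"
  by (simp add: pow_def)

lemma pow_closed: "x \<in> {a..b} \<Longrightarrow> pow x k \<in> {a..b}"
proof (induction k)
  case 0 then show ?case using less by auto
next
  case (Suc k) then show ?case unfolding pow_Suc by (intro closed) auto
qed

lemma pow_add: "x \<in> {a..b} \<Longrightarrow> pow x (m + n) = S (pow x m) (pow x n)"
  by (induction m) (simp_all add: pow_Suc unit pow_closed assoc del: atLeastAtMost_iff)

lemma pow_1: "x \<in> {a..b} \<Longrightarrow> pow x 1 = x"
  using pow_Suc[of x 0] unit by simp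

lemma pow_antimono: "x \<in> {a..b} \<Longrightarrow> m \<le> n \<Longrightarrow> pow x n \<le> pow x m"
  using pow_add[of x m "n - m"] le_left[OF pow_closed pow_closed, of x x m "n - m"] by simp

text \<open>Rewrites powers of \<open>rt n\<close> as powers of its root
  \<open>rt (Suc n)\<close>.\<close>

lemma pow_square: "x \<in> {a..b} \<Longrightarrow> pow (S x x) k = pow x (2 * k)"
proof (induction k)
  case (Suc k)
  then show ?case by (simp add: pow_Suc assoc pow_closed del: atLeastAtMost_iff)
qed simp

end

section \<open>Additive generators of Archimedean t-norms\<close>

locale archimedean_tnorm = tnorm_interval +
  assumes no_idem: "a < x \<Longrightarrow> x < b \<Longrightarrow> S x x \<noteq> x"
begin

text \<open>Continuity makes the limit idempotent. The lemma is meant for sequences of successive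
  roots or squares, whose squared sequence is a shift of the sequence itself.\<close>

lemma limit_idem:
  assumes "X \<longlonglongrightarrow> L" "\<And>n. X n \<in> {a..b}" "(\<lambda>n. S (X n) (X n)) \<longlonglongrightarrow> L"
  shows "L = a \<or> L = b"
proof -
  have "S L L = L"
    using LIMSEQ_unique[OF tendsto[OF assms(1,1) assms(2,2)] assms(3)] .
  moreover have "L \<in> {a..b}"
    using closed_sequentially[OF closed_atLeastAtMost] assms by blast
  ultimately show ?thesis using no_idem[of L] by force
qed

section \<open>Iterated square roots of an interior point\<close>

definition base :: real where "base = (a + b) / 2"

lemma base: "a < base" "base < b"
  using less by (auto simp: base_def)

definition rt :: "nat \<Rightarrow> real" where
  "rt n = ((\<lambda>x. SOME y. y \<in> {a..b} \<and> S y y = x) ^^ n) base"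

lemma rt_0: "rt 0 = base"
  by (simp add: rt_def)

lemma rt_mem: "rt n \<in> {a..b}" and rt_Suc: "S (rt (Suc n)) (rt (Suc n)) = rt n"
proof -
  have *: "rt (Suc n) \<in> {a..b} \<and> S (rt (Suc n)) (rt (Suc n)) = rt n" if "rt n \<in> {a..b}" for n
  proof -
    have "rt (Suc n) = (SOME y. y \<in> {a..b} \<and> S y y = rt n)"
      by (simp add: rt_def)
    then show ?thesis
      using someI_ex[of "\<lambda>y. y \<in> {a..b} \<and> S y y = rt n"] square_root[OF that]
      unfolding Bex_def by presburger
  qed
  have mem: "rt n \<in> {a..b}" for n
  proof (induction n)
    case 0 then show ?case using base by (simp add: rt_0)
  next
    case (Suc n) then show ?case using * by blast
  qed
  show "rt n \<in> {a..b}" "S (rt (Suc n)) (rt (Suc n)) = rt n"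
    using mem * by blast+
qed

text \<open>Roots increase because \<open>S y y <= y\<close>; the limit is an endpoint and is at
  least \<open>X 0 > a\<close>. This serves both \<open>rt\<close> and
  \<open>gen (1 / 2 ^ n)\<close>.\<close>

lemma square_root_sequence_tendsto:
  assumes mem: "\<And>n. X n \<in> {a..b}" and sq: "\<And>n. S (X (Suc n)) (X (Suc n)) = X n" and "a < X 0"
  shows "X \<longlonglongrightarrow> b"
proof -
  have inc: "incseq X"
    using le_left[OF mem mem, of "Suc n" "Suc n" for n] sq by (intro incseq_SucI) simp
  then obtain L where L: "X \<longlonglongrightarrow> L" "\<forall>n. X n \<le> L"
    using incseq_convergent[of X b] mem by auto
  have "(\<lambda>n. S (X (Suc n)) (X (Suc n))) \<longlonglongrightarrow> L"
    using L by (simp add: sq)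
  then have "L = a \<or> L = b"
    using limit_idem[of "\<lambda>n. X (Suc n)" L] LIMSEQ_Suc[OF L(1)] mem by blast
  then show ?thesis using L \<open>a < X 0\<close> by (metis leD)
qed

lemma rt_tendsto: "rt \<longlonglongrightarrow> b"
  using rt_mem rt_Suc base rt_0 by (intro square_root_sequence_tendsto) auto

text \<open>
  The ceiling is subadditive with defect at most one, so \<open>approx\<close> is additive in \<open>t\<close> up to one factor
  \<open>rt n\<close>, which tends to the unit.
\<close>

definition approx :: "real \<Rightarrow> nat \<Rightarrow> real" where
  "approx t n = pow (rt n) (nat \<lceil>t * 2 ^ n\<rceil>)"

definition gen :: "real \<Rightarrow> real" where
  "gen t = lim (approx t)"

lemma approx_mem: "approx t n \<in> {a..b}"
  unfolding approx_def by (intro pow_closed rt_mem)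

text \<open>Passing to the root \<open>rt (Suc n)\<close> doubles the exponent, whereas the ceiling
  on the finer grid is at most twice the coarser one; a smaller exponent gives a larger power.
  Rounding up is what makes the approximations monotone.\<close>

lemma incseq_approx:
  assumes "t \<ge> 0" shows "incseq (approx t)"
proof (rule incseq_SucI)
  fix n
  have "\<lceil>t * 2 ^ Suc n\<rceil> \<le> 2 * \<lceil>t * 2 ^ n\<rceil>"
    unfolding ceiling_le_iff using le_of_int_ceiling[of "t * 2 ^ n"] by simp
  then have "nat \<lceil>t * 2 ^ Suc n\<rceil> \<le> 2 * nat \<lceil>t * 2 ^ n\<rceil>"
    by linarith
  then have "pow (rt (Suc n)) (2 * nat \<lceil>t * 2 ^ n\<rceil>) \<le> approx t (Suc n)"
    unfolding approx_def by (intro pow_antimono rt_mem)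
  then show "approx t n \<le> approx t (Suc n)"
    using pow_square[OF rt_mem, of "Suc n" "nat \<lceil>t * 2 ^ n\<rceil>"]
    by (simp add: approx_def rt_Suc)
qed

lemma approx_tendsto: "t \<ge> 0 \<Longrightarrow> approx t \<longlonglongrightarrow> gen t"
  unfolding gen_def
  using incseq_convergent[OF incseq_approx, of t b] approx_mem
  by (metis atLeastAtMost_iff limI)

lemma gen_mem: "t \<ge> 0 \<Longrightarrow> gen t \<in> {a..b}"
  using closed_sequentially[OF closed_atLeastAtMost] approx_tendsto approx_mem by blast

lemma gen_0: "gen 0 = b"
  using LIMSEQ_unique[OF approx_tendsto[of 0], of b] by (simp add: approx_def[abs_def])

lemma gen_1: "gen 1 = base"
proof -
  have "pow (rt n) (2 ^ n) = base" for n
  proof (induction n)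
    case 0 then show ?case using pow_1[OF rt_mem, of 0] by (simp add: rt_0)
  next
    case (Suc n)
    then show ?case using pow_square[OF rt_mem, of "Suc n" "2 ^ n"] by (simp add: rt_Suc)
  qed
  moreover have "nat \<lceil>(2::real) ^ n\<rceil> = 2 ^ n" for n
    by (metis ceiling_of_nat nat_int of_nat_numeral of_nat_power)
  ultimately have "approx 1 n = base" for n
    unfolding approx_def mult_1_left by metis
  then have "approx 1 = (\<lambda>n. base)" by (rule ext)
  then show ?thesis
    using LIMSEQ_unique[OF approx_tendsto[of 1], of base] by simp
qed

lemma gen_add:
  assumes "s \<ge> 0" "t \<ge> 0" shows "gen (s + t) = S (gen s) (gen t)"
proof -
  define k where "k u n = nat \<lceil>u * 2 ^ n\<rceil>" for u :: real and n :: nat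
  have approx_k: "approx u n = pow (rt n) (k u n)" for u n
    by (simp add: approx_def k_def)
  have k: "k (s + t) n \<le> k s n + k t n" "k s n + k t n \<le> k (s + t) n + 1" for n
  proof -
    have nonneg: "s * 2 ^ n \<ge> 0" "t * 2 ^ n \<ge> 0" using assms by auto
    have "\<lceil>s * 2 ^ n + t * 2 ^ n\<rceil> \<le> \<lceil>s * 2 ^ n\<rceil> + \<lceil>t * 2 ^ n\<rceil>"
      by linarith
    moreover have "\<lceil>s * 2 ^ n\<rceil> + \<lceil>t * 2 ^ n\<rceil> \<le> \<lceil>s * 2 ^ n + t * 2 ^ n\<rceil> + 1"
      by linarith
    moreover have "\<lceil>s * 2 ^ n\<rceil> \<ge> 0" "\<lceil>t * 2 ^ n\<rceil> \<ge> 0" "\<lceil>s * 2 ^ n + t * 2 ^ n\<rceil> \<ge> 0"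
      using nonneg by linarith+
    ultimately show "k (s + t) n \<le> k s n + k t n" "k s n + k t n \<le> k (s + t) n + 1"
      unfolding k_def distrib_right by linarith+
  qed
  have st: "s + t \<ge> 0" using assms by simp
  \<comment> \<open>Powers decrease in the exponent, so both ceiling estimates turn around; the
    extra \<open>1\<close> becomes the factor \<open>rt n\<close>.\<close>
  have upper: "S (approx s n) (approx t n) \<le> approx (s + t) n" for n
    using pow_antimono[OF rt_mem k(1), of n] by (simp add: approx_k pow_add rt_mem del: atLeastAtMost_iff)
  have lower: "S (approx (s + t) n) (rt n) \<le> S (approx s n) (approx t n)" for n
    using pow_antimono[OF rt_mem k(2), of n] pow_1[OF rt_mem]
    by (simp add: approx_k pow_add rt_mem pow_1 del: atLeastAtMost_iff One_nat_def)
  have "(\<lambda>n. S (approx s n) (approx t n)) \<longlonglongrightarrow> S (gen s) (gen t)"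
    using approx_tendsto assms approx_mem by (intro tendsto) auto
  moreover have "(\<lambda>n. S (approx (s + t) n) (rt n)) \<longlonglongrightarrow> S (gen (s + t)) b"
    using approx_tendsto st approx_mem rt_mem rt_tendsto by (intro tendsto) auto
  ultimately have "S (gen (s + t)) b \<le> S (gen s) (gen t)" "S (gen s) (gen t) \<le> gen (s + t)"
    using approx_tendsto[OF st] lower upper by (auto intro: LIMSEQ_le)
  then show ?thesis using unit gen_mem st by simp
qed

section \<open>Monotonicity, limits and continuity of the semigroup\<close>

lemma gen_antimono: "0 \<le> s \<Longrightarrow> s \<le> t \<Longrightarrow> gen t \<le> gen s"
  using gen_add[of s "t - s"] le_left[OF gen_mem gen_mem, of s "t - s"] by simp

lemma gen_small: "(\<lambda>n. gen (1 / 2 ^ n)) \<longlonglongrightarrow> b"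
proof (rule square_root_sequence_tendsto)
  show "S (gen (1 / 2 ^ Suc n)) (gen (1 / 2 ^ Suc n)) = gen (1 / 2 ^ n)" for n
    using gen_add[of "1 / 2 ^ Suc n" "1 / 2 ^ Suc n"] by simp
qed (use gen_mem gen_1 base in auto)

text \<open>At doubling times each value is the square of the previous one, so the limit is an
  endpoint; it is at most \<open>base < b\<close>.\<close>

lemma gen_large: "(\<lambda>n. gen (2 ^ n)) \<longlonglongrightarrow> a"
proof -
  have mem: "gen (2 ^ n) \<in> {a..b}" for n
    by (intro gen_mem) simp
  have "decseq (\<lambda>n. gen (2 ^ n))"
    by (intro decseq_SucI gen_antimono) auto
  then obtain L where L: "(\<lambda>n. gen (2 ^ n)) \<longlonglongrightarrow> L" "\<forall>n. L \<le> gen (2 ^ n)"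
    using decseq_convergent[of "\<lambda>n. gen (2 ^ n)" a] mem by auto
  have "gen (2 ^ Suc n) = S (gen (2 ^ n)) (gen (2 ^ n))" for n
    using gen_add[of "2 ^ n" "2 ^ n"] by simp
  then have "(\<lambda>n. S (gen (2 ^ n)) (gen (2 ^ n))) \<longlonglongrightarrow> L"
    using LIMSEQ_Suc[OF L(1)] by simp
  then have "L = a \<or> L = b"
    using limit_idem[OF L(1)] mem by blast
  moreover have "L \<le> base"
    using L(2) gen_1 by (metis power_0)
  ultimately show ?thesis using L base by auto
qed

lemma gen_below: "\<exists>t\<ge>0. gen t < y" if "a < y" for y
proof -
  have "eventually (\<lambda>n. gen (2 ^ n) < y) sequentially"
    using order_tendstoD(2)[OF gen_large that] .
  then obtain n where "gen (2 ^ n) < y"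
    by (meson eventually_happens trivial_limit_sequentially)
  then show ?thesis by (intro exI[of _ "2 ^ n"]) simp
qed

text \<open>A plateau of length \<open>h\<close> above \<open>a\<close> would repeat forever: if
  adding \<open>h\<close> once leaves the value at \<open>s\<close> unchanged, so does adding it
  \<open>n\<close> times, against \<open>gen_below\<close>. At the value \<open>a\<close> itself a
  plateau is possible.\<close>

lemma gen_strict:
  assumes "0 \<le> s" "s < t" "a < gen s"
  shows "gen t < gen s"
proof (rule ccontr)
  assume "\<not> gen t < gen s"
  then have eq: "gen t = gen s"
    using gen_antimono[of s t] assms by simp
  define h where "h = t - s"
  have h: "h > 0" using assms by (simp add: h_def)
  have step: "gen (s + n * h) = gen s" for n :: nat
  proof (induction n)
    case (Suc n)
    have "gen (s + Suc n * h) = gen (t + n * h)"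
      by (simp add: h_def algebra_simps)
    also have "\<dots> = S (gen t) (gen (n * h))"
      using assms h by (intro gen_add) auto
    also have "\<dots> = gen (s + n * h)"
      using assms h eq gen_add[of s "n * h"] by simp
    finally show ?case using Suc by simp
  qed simp
  obtain u where u: "u \<ge> 0" "gen u < gen s"
    using gen_below[OF assms(3)] by blast
  obtain n :: nat where "u < n * h"
    using reals_Archimedean3[OF h] by blast
  then have "gen (s + n * h) \<le> gen u"
    using u assms by (intro gen_antimono) auto
  then show False using step u by simp
qed

text \<open>By additivity \<open>gen t\<close> is \<open>gen s\<close> times
  \<open>gen (t - s)\<close>, and the second factor is close to the unit for small increments.
  Uniform continuity of \<open>S\<close> on the compact square makes the resulting bound independent
  of \<open>s\<close>.\<close>

lemma gen_continuous: "continuous_on {0..} gen"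
proof -
  have small: "\<exists>h>0. \<forall>s t. 0 \<le> s \<longrightarrow> s \<le> t \<longrightarrow> t \<le> s + h \<longrightarrow> gen s - gen t < e" if e: "e > 0" for e
  proof -
    have "uniformly_continuous_on ({a..b} \<times> {a..b}) (\<lambda>(x, y). S x y)"
      by (intro compact_uniformly_continuous continuous compact_Times compact_Icc)
    then obtain \<delta> where \<delta>: "\<delta> > 0" "\<And>p q. p \<in> {a..b} \<times> {a..b} \<Longrightarrow> q \<in> {a..b} \<times> {a..b} \<Longrightarrow>
        dist q p < \<delta> \<Longrightarrow> dist (case q of (x, y) \<Rightarrow> S x y) (case p of (x, y) \<Rightarrow> S x y) < e"
      unfolding uniformly_continuous_on_def using e by metis
    \<comment> \<open>For increments up to \<open>1 / 2 ^ n\<close> the factor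
      \<open>gen (t - s)\<close> stays within \<open>\<delta>\<close> of the unit.\<close>
    obtain n where n: "b - \<delta> < gen (1 / 2 ^ n)"
      using order_tendstoD(1)[OF gen_small, of "b - \<delta>"] \<delta>(1)
      by (auto simp: eventually_sequentially)
    show ?thesis
    proof (intro exI conjI allI impI)
      show "(1 / 2 ^ n :: real) > 0" by simp
      fix s t :: real assume st: "0 \<le> s" "s \<le> t" "t \<le> s + 1 / 2 ^ n"
      define x y where "x = gen s" and "y = gen (t - s)"
      have "gen (1 / 2 ^ n) \<le> y"
        unfolding y_def using st by (intro gen_antimono) auto
      moreover have mem: "x \<in> {a..b}" "y \<in> {a..b}" "b \<in> {a..b}"
        using gen_mem st less by (auto simp: x_def y_def)
      ultimately have "dist (x, b) (x, y) < \<delta>"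
        using n by (simp add: dist_Pair_Pair dist_real_def)
      then have "dist (S x b) (S x y) < e"
        using \<delta>(2)[of "(x, y)" "(x, b)"] mem by auto
      moreover have "gen t = S x y"
        using gen_add[of s "t - s"] st by (simp add: x_def y_def)
      ultimately show "gen s - gen t < e"
        using unit(1)[OF mem(1)] by (simp add: dist_real_def x_def)
    qed
  qed
  show ?thesis
    unfolding continuous_on_iff
  proof (intro ballI allI impI)
    fix t e :: real assume t: "t \<in> {0..}" and "0 < e"
    then obtain h where h: "h > 0"
      "\<And>s t. 0 \<le> s \<Longrightarrow> s \<le> t \<Longrightarrow> t \<le> s + h \<Longrightarrow> gen s - gen t < e"
      using small by blast
    show "\<exists>d>0. \<forall>s\<in>{0..}. dist s t < d \<longrightarrow> dist (gen s) (gen t) < e"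
    proof (intro exI conjI ballI impI)
      fix s :: real assume s: "s \<in> {0..}" "dist s t < h"
      then show "dist (gen s) (gen t) < e"
        using h(2)[of s t] h(2)[of t s] gen_antimono[of s t] gen_antimono[of t s] t
        by (auto simp: dist_real_def abs_if split: if_splits)
    qed (rule h(1))
  qed
qed

text \<open>The bottom is excluded because \<open>gen\<close> may only approach it.\<close>

lemma gen_onto:
  assumes "a < y" "y \<le> b" shows "\<exists>t\<ge>0. gen t = y"
proof -
  obtain u where u: "u \<ge> 0" "gen u < y" using gen_below assms by blast
  then show ?thesis
    using IVT2'[of gen u y 0] gen_0 assms continuous_on_subset[OF gen_continuous, of "{0..u}"] by auto
qed

end

section \<open>Isomorphisms of t-norms\<close>

text \<open>Exposes the witness hidden in \<open>tnorm_isomorphic\<close>, so that it can be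
  restricted, inverted and composed, and phrases the order isomorphism as strict monotonicity with a
  prescribed image.\<close>

definition tnorm_iso ::
    "real \<Rightarrow> real \<Rightarrow> (real \<Rightarrow> real \<Rightarrow> real) \<Rightarrow> real \<Rightarrow> real \<Rightarrow> (real \<Rightarrow> real \<Rightarrow> real) \<Rightarrow> (real \<Rightarrow> real) \<Rightarrow> bool" where
  "tnorm_iso a b S c d T \<phi> \<longleftrightarrow>
     strict_mono_on {a..b} \<phi> \<and> \<phi> ` {a..b} = {c..d} \<and>
     (\<forall>x\<in>{a..b}. \<forall>y\<in>{a..b}. \<phi> (S x y) = T (\<phi> x) (\<phi> y))"

lemma order_iso_between_strict_mono:
  fixes A :: "'a :: linorder set" and B :: "'b :: linorder set"
  shows "order_iso_between A (\<le>) B (\<le>) f \<longleftrightarrow> strict_mono_on A f \<and> f ` A = B"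
proof
  assume "order_iso_between A (\<le>) B (\<le>) f"
  then show "strict_mono_on A f \<and> f ` A = B"
    unfolding order_iso_between_def bij_betw_def
    by (auto intro!: strict_mono_onI simp: less_le dest: inj_onD)
next
  assume *: "strict_mono_on A f \<and> f ` A = B"
  then have "bij_betw f A B"
    by (simp add: bij_betw_def strict_mono_on_imp_inj_on)
  with * show "order_iso_between A (\<le>) B (\<le>) f"
    unfolding order_iso_between_def by (auto simp: strict_mono_on_leD strict_mono_on_less_eq)
qed

lemma tnorm_isomorphic_iff:
  "tnorm_isomorphic a b S c d T \<longleftrightarrow>
    continuous_tnorm a b S \<and> continuous_tnorm c d T \<and> (\<exists>\<phi>. tnorm_iso a b S c d T \<phi>)"
  by (simp add: tnorm_isomorphic_def tnorm_iso_def order_iso_between_strict_mono)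

lemma tnorm_iso_mem: "tnorm_iso a b S c d T \<phi> \<Longrightarrow> x \<in> {a..b} \<Longrightarrow> \<phi> x \<in> {c..d}"
  unfolding tnorm_iso_def by blast

lemma tnorm_iso_less_iff:
  "tnorm_iso a b S c d T \<phi> \<Longrightarrow> x \<in> {a..b} \<Longrightarrow> y \<in> {a..b} \<Longrightarrow> \<phi> x < \<phi> y \<longleftrightarrow> x < y"
  by (rule strict_mono_on_less[of "{a..b}"]) (simp_all add: tnorm_iso_def del: atLeastAtMost_iff)

lemma tnorm_iso_le_iff:
  "tnorm_iso a b S c d T \<phi> \<Longrightarrow> x \<in> {a..b} \<Longrightarrow> y \<in> {a..b} \<Longrightarrow> \<phi> x \<le> \<phi> y \<longleftrightarrow> x \<le> y"
  by (rule strict_mono_on_less_eq[of "{a..b}"]) (simp_all add: tnorm_iso_def del: atLeastAtMost_iff)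

lemma tnorm_iso_eq_iff:
  "tnorm_iso a b S c d T \<phi> \<Longrightarrow> x \<in> {a..b} \<Longrightarrow> y \<in> {a..b} \<Longrightarrow> \<phi> x = \<phi> y \<longleftrightarrow> x = y"
  by (rule strict_mono_on_eq[of "{a..b}"]) (simp_all add: tnorm_iso_def del: atLeastAtMost_iff)

lemma tnorm_iso_hom:
  "tnorm_iso a b S c d T \<phi> \<Longrightarrow> x \<in> {a..b} \<Longrightarrow> y \<in> {a..b} \<Longrightarrow> \<phi> (S x y) = T (\<phi> x) (\<phi> y)"
  unfolding tnorm_iso_def by blast

lemma tnorm_iso_onto:
  "tnorm_iso a b S c d T \<phi> \<Longrightarrow> y \<in> {c..d} \<Longrightarrow> \<exists>x\<in>{a..b}. \<phi> x = y"
  unfolding tnorm_iso_def by (metis imageE)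

lemma tnorm_iso_inverse:
  assumes "continuous_tnorm a b S" and \<phi>: "tnorm_iso a b S c d T \<phi>"
  shows "tnorm_iso c d T a b S (inv_into {a..b} \<phi>)"
proof -
  interpret tnorm_interval a b S by unfold_locales fact
  let ?\<psi> = "inv_into {a..b} \<phi>"
  have onto: "\<phi> ` {a..b} = {c..d}" and inj: "inj_on \<phi> {a..b}"
    using \<phi> by (auto simp: tnorm_iso_def strict_mono_on_imp_inj_on)
  have \<psi>: "?\<psi> y \<in> {a..b}" "\<phi> (?\<psi> y) = y" if "y \<in> {c..d}" for y
    using that inv_into_into[of y \<phi> "{a..b}"] f_inv_into_f[of y \<phi> "{a..b}"] onto by auto
  have "strict_mono_on {c..d} ?\<psi>"
    by (rule strict_mono_onI) (metis \<psi> tnorm_iso_less_iff[OF \<phi>])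
  moreover have "?\<psi> ` {c..d} = {a..b}"
    using onto inj by (metis inv_into_image_cancel order_refl)
  moreover have "?\<psi> (T x y) = S (?\<psi> x) (?\<psi> y)" if "x \<in> {c..d}" "y \<in> {c..d}" for x y
    using tnorm_iso_hom[OF \<phi> \<psi>(1)[OF that(1)] \<psi>(1)[OF that(2)]]
      inv_into_f_f[OF inj closed[OF \<psi>(1)[OF that(1)] \<psi>(1)[OF that(2)]]] \<psi>(2) that
    by simp
  ultimately show ?thesis
    unfolding tnorm_iso_def by blast
qed

lemma tnorm_iso_compose:
  assumes "tnorm_iso a b S c d T \<phi>" and "tnorm_iso c d T e f U \<psi>"
  shows "tnorm_iso a b S e f U (\<psi> \<circ> \<phi>)"
proof -
  have "strict_mono_on {a..b} (\<psi> \<circ> \<phi>)"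
    using assms by (auto intro!: strict_mono_onI simp: tnorm_iso_less_iff tnorm_iso_mem simp del: atLeastAtMost_iff)
  moreover have "(\<psi> \<circ> \<phi>) ` {a..b} = {e..f}"
    using assms unfolding tnorm_iso_def by (metis image_comp)
  moreover have "(\<psi> \<circ> \<phi>) (S x y) = U ((\<psi> \<circ> \<phi>) x) ((\<psi> \<circ> \<phi>) y)" if "x \<in> {a..b}" "y \<in> {a..b}" for x y
    using tnorm_iso_hom[OF assms(1) that] tnorm_iso_hom[OF assms(2)] tnorm_iso_mem[OF assms(1)] that by auto
  ultimately show ?thesis unfolding tnorm_iso_def by blast
qed

lemma tnorm_isomorphic_sym: "tnorm_isomorphic a b S c d T \<Longrightarrow> tnorm_isomorphic c d T a b S"
  unfolding tnorm_isomorphic_iff using tnorm_iso_inverse by blast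

lemma tnorm_isomorphic_trans:
  "tnorm_isomorphic a b S c d T \<Longrightarrow> tnorm_isomorphic c d T e f U \<Longrightarrow> tnorm_isomorphic a b S e f U"
  unfolding tnorm_isomorphic_iff using tnorm_iso_compose by blast

section \<open>Classification of Archimedean t-norms\<close>

context archimedean_tnorm
begin

text \<open>\<open>- ln\<close> turns products into sums, and \<open>gen\<close> turns sums into
  \<open>S\<close>.\<close>

lemma isomorphic_product:
  assumes pos: "\<And>t. t \<ge> 0 \<Longrightarrow> a < gen t"
  shows "tnorm_isomorphic a b S 0 1 product_tnorm"
proof (rule tnorm_isomorphic_sym)
  \<comment> \<open>The value of \<open>ln\<close> at \<open>0\<close> is a mere convention, so the
    limit \<open>a\<close> of \<open>gen\<close> at infinity is put in by hand.\<close>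
  define \<psi> where "\<psi> p = (if p = 0 then a else gen (- ln p))" for p :: real
  have "strict_mono_on {0..1} \<psi>"
    by (rule strict_mono_onI) (auto simp: \<psi>_def intro!: gen_strict pos)
  moreover have "\<psi> ` {0..1} = {a..b}"
  proof
    show "\<psi> ` {0..1} \<subseteq> {a..b}"
      using less gen_mem by (auto simp: \<psi>_def)
    show "{a..b} \<subseteq> \<psi> ` {0..1}"
    proof
      fix y assume y: "y \<in> {a..b}"
      show "y \<in> \<psi> ` {0..1}"
      proof (cases "y = a")
        case True
        then show ?thesis by (intro image_eqI[of _ _ 0]) (auto simp: \<psi>_def)
      next
        case False
        then obtain t where "t \<ge> 0" "gen t = y" using gen_onto[of y] y by auto
        then show ?thesis by (intro image_eqI[of _ _ "exp (- t)"]) (auto simp: \<psi>_def)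
      qed
    qed
  qed
  moreover have "\<psi> (product_tnorm p q) = S (\<psi> p) (\<psi> q)" if "p \<in> {0..1}" "q \<in> {0..1}" for p q
  proof (cases "p = 0 \<or> q = 0")
    case True
    then show ?thesis
      using that gen_mem less bot by (auto simp: \<psi>_def product_tnorm_def)
  next
    case False
    then have "- ln (p * q) = - ln p + - ln q" "- ln p \<ge> 0" "- ln q \<ge> 0"
      using that by (auto simp: ln_mult)
    then show ?thesis
      using False gen_add[of "- ln p" "- ln q"] by (simp add: \<psi>_def product_tnorm_def)
  qed
  ultimately show "tnorm_isomorphic 0 1 product_tnorm a b S"
    unfolding tnorm_isomorphic_iff tnorm_iso_def using tnorm continuous_tnorm_product by blast
qed

text \<open>Time is rescaled so that the bottom is first reached at \<open>p = 0\<close>. The sum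
  \<open>l * (1 - p) + l * (1 - q)\<close> equals \<open>l * (1 - (p + q - 1))\<close>, and since
  \<open>gen\<close> stays at \<open>a\<close> beyond \<open>l\<close>, truncation at
  \<open>0\<close> is respected.\<close>

lemma isomorphic_lukasiewicz:
  assumes zero: "t \<ge> 0" "gen t = a"
  shows "tnorm_isomorphic a b S 0 1 lukasiewicz_tnorm"
proof (rule tnorm_isomorphic_sym)
  define Z where "Z = {t. 0 \<le> t \<and> gen t = a}"
  \<comment> \<open>The first time at which \<open>gen\<close> reaches \<open>a\<close>; continuity
    makes the set of such times closed, so the infimum is attained.\<close>
  define l where "l = Inf Z"
  have bdd: "bdd_below Z" by (auto simp: Z_def bdd_below_def)
  have "closed ({0..} \<inter> gen -` {a})"
    using gen_continuous by (intro continuous_closed_preimage) auto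
  moreover have "{0..} \<inter> gen -` {a} = Z" by (auto simp: Z_def)
  ultimately have "l \<in> Z"
    unfolding l_def using zero bdd by (intro closed_contains_Inf) (auto simp: Z_def)
  then have l: "l \<ge> 0" "gen l = a" by (auto simp: Z_def)
  have below: "a < gen t" if "0 \<le> t" "t < l" for t
  proof -
    have "t \<notin> Z" using cInf_lower[OF _ bdd, of t] that by (auto simp: l_def)
    then show ?thesis using that gen_mem[of t] by (auto simp: Z_def)
  qed
  have above: "gen t = a" if "t \<ge> l" for t
    using gen_antimono[of l t] gen_mem[of t] l that by auto
  have "l > 0" using l gen_0 less by (cases "l = 0") auto
  define \<psi> where "\<psi> p = gen (l * (1 - p))" for p :: real
  have "strict_mono_on {0..1} \<psi>"
  proof (rule strict_mono_onI)
    fix p q :: real assume pq: "p \<in> {0..1}" "q \<in> {0..1}" "p < q"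
    then have q: "0 \<le> l * (1 - q)" "l * (1 - q) < l * (1 - p)" "l * (1 - q) < l"
      using \<open>l > 0\<close> by (auto simp: algebra_simps)
    then show "\<psi> p < \<psi> q"
      unfolding \<psi>_def by (intro gen_strict below)
  qed
  moreover have "\<psi> ` {0..1} = {a..b}"
  proof
    show "\<psi> ` {0..1} \<subseteq> {a..b}"
      using l unfolding \<psi>_def by (intro image_subsetI gen_mem) auto
    show "{a..b} \<subseteq> \<psi> ` {0..1}"
    proof
      fix y assume "y \<in> {a..b}"
      then obtain t where t: "0 \<le> t" "t \<le> l" "gen t = y"
        using IVT2'[of gen l y 0] gen_0 l continuous_on_subset[OF gen_continuous, of "{0..l}"] by auto
      then show "y \<in> \<psi> ` {0..1}"
        using \<open>l > 0\<close> by (intro image_eqI[of _ _ "1 - t / l"]) (auto simp: \<psi>_def)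
    qed
  qed
  moreover have "\<psi> (lukasiewicz_tnorm p q) = S (\<psi> p) (\<psi> q)" if pq: "p \<in> {0..1}" "q \<in> {0..1}" for p q
  proof -
    define s where "s = l * (1 - p) + l * (1 - q)"
    have sum: "S (\<psi> p) (\<psi> q) = gen s"
      unfolding \<psi>_def s_def using pq l by (intro gen_add[symmetric]) auto
    show ?thesis
    proof (cases "p + q - 1 \<ge> 0")
      case True
      then have "l * (1 - lukasiewicz_tnorm p q) = s"
        by (simp add: lukasiewicz_tnorm_def s_def algebra_simps)
      then show ?thesis using sum by (simp add: \<psi>_def)
    next
      case False
      have "s = l + l * (1 - p - q)" by (simp add: s_def algebra_simps)
      then have "gen s = a" using False l by (intro above) simp
      then show ?thesis using sum False l by (simp add: \<psi>_def lukasiewicz_tnorm_def)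
    qed
  qed
  ultimately show "tnorm_isomorphic 0 1 lukasiewicz_tnorm a b S"
    unfolding tnorm_isomorphic_iff tnorm_iso_def using tnorm continuous_tnorm_lukasiewicz by blast
qed

lemma isomorphic_product_or_lukasiewicz:
  "tnorm_isomorphic a b S 0 1 product_tnorm \<or> tnorm_isomorphic a b S 0 1 lukasiewicz_tnorm"
proof (cases "\<forall>t\<ge>0. a < gen t")
  case True then show ?thesis using isomorphic_product by blast
next
  case False
  then obtain t where "t \<ge> 0" "gen t = a" using gen_mem by force
  then show ?thesis using isomorphic_lukasiewicz by blast
qed

end

section \<open>The intervals of a t-norm on the unit interval\<close>

text \<open>Describes a component by order and idempotence alone, with idempotent endpoints in place
  of topological maximality; this form is easy to transport along isomorphisms.\<close>

definition gap :: "(real \<Rightarrow> real \<Rightarrow> real) \<Rightarrow> real \<Rightarrow> real \<Rightarrow> bool" where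
  "gap T a b \<longleftrightarrow> 0 \<le> a \<and> a < b \<and> b \<le> 1 \<and> T a a = a \<and> T b b = b \<and>
     (\<forall>x. a < x \<longrightarrow> x < b \<longrightarrow> T x x \<noteq> x)"

text \<open>A non-idempotent endpoint could be added to give a larger connected set; conversely, a
  connected set leaving the interval would contain one of its idempotent endpoints.\<close>

lemma component_iff_gap: "{a<..<b} \<in> components (non_idempotents T) \<longleftrightarrow> gap T a b"
proof
  assume comp: "{a<..<b} \<in> components (non_idempotents T)"
  then have ab: "a < b" and sub: "{a<..<b} \<subseteq> non_idempotents T"
    using in_components_nonempty in_components_subset by fastforce+
  have "{a<..<b} \<subseteq> {0..1}"
    using sub by (auto simp: non_idempotents_def)
  then have bounds: "0 \<le> a" "b \<le> 1"
    using ab by (auto simp: greaterThanLessThan_subseteq_atLeastAtMost_iff)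
  have maximal: "A = {a<..<b}" if "{a<..<b} \<subseteq> A" "A \<subseteq> non_idempotents T" "connected A" for A
    using comp that ab unfolding in_components_maximal by (metis greaterThanLessThan_empty_iff not_le subset_empty)
  have "a \<notin> non_idempotents T"
  proof
    assume "a \<in> non_idempotents T"
    then have "{a..<b} \<subseteq> non_idempotents T" using sub by (auto simp: less_le)
    then have "{a..<b} = {a<..<b}"
      by (intro maximal) auto
    then show False using ab by (metis atLeastLessThan_iff greaterThanLessThan_iff less_irrefl order_refl)
  qed
  moreover have "b \<notin> non_idempotents T"
  proof
    assume "b \<in> non_idempotents T"
    then have "{a<..b} \<subseteq> non_idempotents T" using sub by (auto simp: less_le)
    then have "{a<..b} = {a<..<b}"
      by (intro maximal) auto
    then show False using ab by (metis greaterThanAtMost_iff greaterThanLessThan_iff less_irrefl order_refl)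
  qed
  ultimately show "gap T a b"
    using ab bounds sub by (auto simp: gap_def non_idempotents_def subset_iff)
next
  assume gap: "gap T a b"
  have "A = {a<..<b}" if A: "{a<..<b} \<subseteq> A" "A \<subseteq> non_idempotents T" "connected A" for A
  proof -
    have "a \<notin> A" "b \<notin> A"
      using gap A(2) by (auto simp: gap_def non_idempotents_def)
    define m where "m = (a + b) / 2"
    have m: "a < m" "m < b" using gap by (auto simp: m_def gap_def)
    then have "m \<in> A" using A(1) by auto
    have "a < x \<and> x < b" if "x \<in> A" for x
    proof (rule ccontr)
      assume "\<not> (a < x \<and> x < b)"
      then consider "x \<le> a" | "b \<le> x" by linarith
      then show False
      proof cases
        case 1
        then show False
          using connectedD_interval[OF A(3) \<open>x \<in> A\<close> \<open>m \<in> A\<close>, of a] m \<open>a \<notin> A\<close> by auto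
      next
        case 2
        then show False
          using connectedD_interval[OF A(3) \<open>m \<in> A\<close> \<open>x \<in> A\<close>, of b] m \<open>b \<notin> A\<close> by auto
      qed
    qed
    then show ?thesis using A(1) by auto
  qed
  then show "{a<..<b} \<in> components (non_idempotents T)"
    unfolding in_components_maximal using gap by (auto simp: gap_def non_idempotents_def)
qed

text \<open>The endpoints are idempotent, so the restriction is a t-norm without interior
  idempotents and the classification applies.\<close>

lemma gap_kind:
  assumes T: "continuous_tnorm 0 1 T" and gap: "gap T a b"
  shows "(a, b) \<in> intervals_of_kind Product T \<or> (a, b) \<in> intervals_of_kind Lukasiewicz T"
proof -
  interpret T: tnorm_interval 0 1 T by unfold_locales fact
  have "continuous_tnorm a b T"
    using gap by (intro T.restrict) (auto simp: gap_def)
  then interpret archimedean_tnorm a b T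
    using gap by unfold_locales (auto simp: gap_def)
  show ?thesis
    using isomorphic_product_or_lukasiewicz gap by (simp add: component_iff_gap)
qed

text \<open>The endpoints are the idempotents nearest to \<open>x\<close>: the set of idempotents is
  closed and contains \<open>0\<close> and \<open>1\<close>, so both extrema exist and are
  attained.\<close>

lemma non_idempotent_in_gap:
  assumes T: "continuous_tnorm 0 1 T" and x: "x \<in> {0..1}" "T x x \<noteq> x"
  obtains a b where "gap T a b" "a < x" "x < b"
proof -
  interpret T: tnorm_interval 0 1 T by unfold_locales fact
  define E where "E = {q \<in> {0..1}. T q q - q = 0}"
  have "closed E"
    unfolding E_def by (intro continuous_closed_preimage_constant continuous_intros T.continuous_compose) auto
  have E01: "0 \<in> E" "1 \<in> E" using T.bot T.unit by (auto simp: E_def)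
  define a b where "a = Sup (E \<inter> {..x})" and "b = Inf (E \<inter> {x..})"
  have bdd: "bdd_above (E \<inter> {..x})" "bdd_below (E \<inter> {x..})" by auto
  have "a \<in> E \<inter> {..x}"
    unfolding a_def using E01 x \<open>closed E\<close> by (intro closed_contains_Sup closed_Int) auto
  moreover have "b \<in> E \<inter> {x..}"
    unfolding b_def using E01 x \<open>closed E\<close> by (intro closed_contains_Inf closed_Int) auto
  moreover have "x \<notin> E" using x by (auto simp: E_def)
  ultimately have ab: "a \<in> E" "b \<in> E" "a < x" "x < b"
    by (auto simp: less_le)
  have "y \<notin> E" if "a < y" "y < b" for y
  proof
    assume y: "y \<in> E"
    show False
    proof (cases "y \<le> x")
      case True
      then show False using cSup_upper[OF _ bdd(1), of y] y that by (simp add: a_def)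
    next
      case False
      then show False using cInf_lower[OF _ bdd(2), of y] y that by (simp add: b_def)
    qed
  qed
  then have "gap T a b"
    using ab by (auto simp: gap_def E_def)
  then show thesis using that ab by blast
qed

lemma idempotent_in_Minimum:
  assumes cd: "idempotent_interval T c d" "c < x" "x < d"
  obtains a b where "(a, b) \<in> intervals_of_kind Minimum T" "a < x" "x < b"
proof -
  define N where "N = non_idempotents T"
  \<comment> \<open>The nearest obstructions on either side of \<open>x\<close>; \<open>0\<close>
    and \<open>1\<close> stand in when a side has no non-idempotents.\<close>
  define a b where "a = Sup (insert 0 (N \<inter> {..x}))" and "b = Inf (insert 1 (N \<inter> {x..}))"
  have bdd: "bdd_above (insert 0 (N \<inter> {..x}))" "bdd_below (insert 1 (N \<inter> {x..}))" by auto
  have ac: "a \<le> c'" and bd: "d' \<le> b" if "idempotent_interval T c' d'" "c' < x" "x < d'" for c' d'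
  proof -
    have out: "y \<le> c' \<or> d' \<le> y" if "y \<in> N" for y
      using that \<open>idempotent_interval T c' d'\<close> by (force simp: N_def non_idempotents_def idempotent_interval_def)
    show "a \<le> c'"
      unfolding a_def using out that by (intro cSup_least) (force simp: idempotent_interval_def)+
    show "d' \<le> b"
      unfolding b_def using out that by (intro cInf_greatest) (force simp: idempotent_interval_def)+
  qed
  have bounds: "0 \<le> a" "b \<le> 1"
    unfolding a_def b_def using bdd by (auto intro: cSup_upper cInf_lower)
  have axb: "a < x" "x < b" using ac[OF cd] bd[OF cd] cd by auto
  have "T q q = q" if "a < q" "q < b" for q
  proof (rule ccontr)
    assume "T q q \<noteq> q"
    then have "q \<in> N" using that bounds by (auto simp: N_def non_idempotents_def)
    then show False
      using cSup_upper[OF _ bdd(1), of q] cInf_lower[OF _ bdd(2), of q] that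
      by (cases "q \<le> x") (auto simp: a_def[symmetric] b_def[symmetric])
  qed
  then have "idempotent_interval T a b"
    using bounds axb by (auto simp: idempotent_interval_def)
  moreover have "{c'<..<d'} = {a<..<b}" if "idempotent_interval T c' d'" "{a<..<b} \<subseteq> {c'<..<d'}" for c' d'
  proof -
    have "c' < x" "x < d'" using that axb by auto
    moreover have "c' \<le> a" "b \<le> d'"
      using that axb by (auto simp: greaterThanLessThan_subseteq_greaterThanLessThan)
    ultimately have "c' = a" "d' = b" using ac bd that(1) by fastforce+
    then show ?thesis by simp
  qed
  ultimately show thesis
    using axb by (intro that[of a b]) auto
qed

lemma Upsilon_iff:
  assumes "continuous_tnorm 0 1 T"
  shows "(a, b) \<in> Upsilon T \<longleftrightarrow> gap T a b \<or> (a, b) \<in> intervals_of_kind Minimum T"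
  using gap_kind[OF assms] by (auto simp: Upsilon_def component_iff_gap)

lemma intervals_of_kind_subset_Upsilon: "intervals_of_kind i T \<subseteq> Upsilon T"
  by (cases i) (auto simp: Upsilon_def)

lemma Upsilon_kind: "I \<in> Upsilon T \<Longrightarrow> \<exists>i. I \<in> intervals_of_kind i T"
  unfolding Upsilon_def by blast

lemma kind_gap: "(a, b) \<in> intervals_of_kind i T \<Longrightarrow> i \<noteq> Minimum \<Longrightarrow> gap T a b"
  by (cases i) (auto simp: component_iff_gap)

text \<open>The union of two such intervals sharing \<open>x\<close> is again an interval of
  idempotents, so maximality identifies both with it.\<close>

lemma Minimum_disjoint:
  assumes "(a, b) \<in> intervals_of_kind Minimum T" "(c, d) \<in> intervals_of_kind Minimum T"
    "a < x" "x < b" "c < x" "x < d"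
  shows "(a, b) = (c, d)"
proof -
  have "idempotent_interval T (min a c) (max b d)"
    unfolding idempotent_interval_def
  proof (intro conjI ballI)
    fix q assume "q \<in> {min a c<..<max b d}"
    then have "q \<in> {a<..<b} \<or> q \<in> {c<..<d}" using assms by auto
    then show "T q q = q" using assms by (auto simp: idempotent_interval_def)
  qed (use assms in \<open>auto simp: idempotent_interval_def\<close>)
  moreover have "{a<..<b} \<subseteq> {min a c<..<max b d}" "{c<..<d} \<subseteq> {min a c<..<max b d}" by auto
  ultimately have "{min a c<..<max b d} = {a<..<b}" "{min a c<..<max b d} = {c<..<d}"
    using assms by auto
  then have "{a<..<b} = {c<..<d}" by simp
  then show ?thesis using assms by (auto simp: greaterThanLessThan_eq_iff)
qed

text \<open>Otherwise an endpoint of one gap, an idempotent, would lie inside the other.\<close>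

lemma gap_disjoint:
  assumes "gap T a b" "gap T c d" "a < x" "x < b" "c < x" "x < d"
  shows "(a, b) = (c, d)"
proof -
  have "\<not> a < c" "\<not> c < a" "\<not> b < d" "\<not> d < b"
    using assms by (auto simp: gap_def)
  then show ?thesis by auto
qed

lemma Upsilon_disjoint:
  assumes T: "continuous_tnorm 0 1 T" and U: "(a, b) \<in> Upsilon T" "(c, d) \<in> Upsilon T"
    and x: "a < x" "x < b" "c < x" "x < d"
  shows "(a, b) = (c, d)"
proof -
  have "\<not> gap T p q" if "(p', q') \<in> intervals_of_kind Minimum T" "p < x" "x < q" "p' < x" "x < q'" for p q p' q'
    using that by (auto simp: gap_def idempotent_interval_def)
  then consider "gap T a b" "gap T c d" |
    "(a, b) \<in> intervals_of_kind Minimum T" "(c, d) \<in> intervals_of_kind Minimum T"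
    using U x unfolding Upsilon_iff[OF T] by blast
  then show ?thesis
    using gap_disjoint[OF _ _ x] Minimum_disjoint[OF _ _ x] by cases blast+
qed

text \<open>Isolates what gluing needs, apart from any t-norm: the open intervals need not cover
  \<open>[0, 1]\<close>, but their union must be dense in it.\<close>

definition dense_interval_family :: "(real \<times> real) set \<Rightarrow> bool" where
  "dense_interval_family U \<longleftrightarrow>
     (\<forall>I\<in>U. 0 \<le> fst I \<and> fst I < snd I \<and> snd I \<le> 1) \<and>
     (\<forall>I\<in>U. \<forall>J\<in>U. I = J \<or> I \<prec> J \<or> J \<prec> I) \<and>
     (\<forall>x y. 0 \<le> x \<longrightarrow> x < y \<longrightarrow> y \<le> 1 \<longrightarrow> (\<exists>I\<in>U. \<exists>z\<in>{fst I<..<snd I}. x < z \<and> z < y))"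

text \<open>For density: either all points between \<open>x\<close> and \<open>y\<close> are
  idempotent, and a maximal idempotent interval surrounds any of them, or some point there is not,
  and its gap does.\<close>

lemma dense_interval_family_Upsilon:
  assumes T: "continuous_tnorm 0 1 T"
  shows "dense_interval_family (Upsilon T)"
  unfolding dense_interval_family_def
proof (intro conjI allI impI)
  show bounds: "\<forall>I\<in>Upsilon T. 0 \<le> fst I \<and> fst I < snd I \<and> snd I \<le> 1"
    unfolding Ball_def split_paired_All Upsilon_iff[OF T]
    by (auto simp: gap_def idempotent_interval_def)
  show "\<forall>I\<in>Upsilon T. \<forall>J\<in>Upsilon T. I = J \<or> I \<prec> J \<or> J \<prec> I"
  proof (intro ballI)
    fix I J :: "real \<times> real" assume U: "I \<in> Upsilon T" "J \<in> Upsilon T"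
    obtain a b c d where eq: "I = (a, b)" "J = (c, d)" by (cases I, cases J)
    show "I = J \<or> I \<prec> J \<or> J \<prec> I"
    proof (cases "I \<prec> J \<or> J \<prec> I")
      case False
      then have "max a c < min b d" using U eq bounds by (force simp: interval_prec_def)
      then obtain x where "max a c < x" "x < min b d" using dense by blast
      then show ?thesis using Upsilon_disjoint[OF T, of a b c d x] U eq by auto
    qed auto
  qed
  fix x y :: real assume xy: "0 \<le> x" "x < y" "y \<le> 1"
  have hit: "\<exists>I\<in>Upsilon T. \<exists>z\<in>{fst I<..<snd I}. x < z \<and> z < y"
    if "(a, b) \<in> Upsilon T" "a < z" "z < b" "x < z" "z < y" for a b z
    using that by (intro bexI[of _ "(a, b)"] bexI[of _ z]) auto
  show "\<exists>I\<in>Upsilon T. \<exists>z\<in>{fst I<..<snd I}. x < z \<and> z < y"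
  proof (cases "idempotent_interval T x y")
    case True
    obtain z where z: "x < z" "z < y" using xy dense by blast
    then obtain a b where "(a, b) \<in> intervals_of_kind Minimum T" "a < z" "z < b"
      using idempotent_in_Minimum[OF True, of z] by auto
    then show ?thesis using z Upsilon_iff[OF T] hit by blast
  next
    case False
    then obtain z where z: "x < z" "z < y" "T z z \<noteq> z"
      using xy by (auto simp: idempotent_interval_def)
    then obtain a b where "gap T a b" "a < z" "z < b"
      using non_idempotent_in_gap[OF T, of z] xy by auto
    then show ?thesis using z Upsilon_iff[OF T] hit by blast
  qed
qed

section \<open>Gluing order isomorphisms\<close>

text \<open>Surjectivity onto an interval replaces the intermediate value theorem: preimages exist,
  and strict monotonicity places them between \<open>a\<close> and \<open>b\<close>.\<close>

lemma strict_mono_on_image_intervals: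
  fixes f :: "real \<Rightarrow> real"
  assumes f: "strict_mono_on {p..q} f" "f ` {p..q} = {r..s}" and ab: "p \<le> a" "a \<le> b" "b \<le> q"
  shows "f ` {a..b} = {f a..f b}" and "f ` {a<..<b} = {f a<..<f b}"
proof -
  have less: "f x < f y \<longleftrightarrow> x < y" and le: "f x \<le> f y \<longleftrightarrow> x \<le> y"
    if "p \<le> x" "x \<le> q" "p \<le> y" "y \<le> q" for x y
    using that strict_mono_on_less[OF f(1), of x y] strict_mono_on_less_eq[OF f(1), of x y] by auto
  have "f a \<in> {r..s}" "f b \<in> {r..s}"
    using f(2) ab by (auto simp flip: f(2))
  then have onto: "\<exists>x\<in>{p..q}. y = f x" if "f a \<le> y" "y \<le> f b" for y
    using that f(2) unfolding image_iff[symmetric] by auto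
  show "f ` {a..b} = {f a..f b}"
  proof (intro equalityI subsetI)
    fix y assume y: "y \<in> {f a..f b}"
    then obtain x where "x \<in> {p..q}" "y = f x" using onto[of y] by auto
    then show "y \<in> f ` {a..b}" using y ab by (intro image_eqI[of _ _ x]) (auto simp: le)
  qed (use ab in \<open>auto simp: le\<close>)
  show "f ` {a<..<b} = {f a<..<f b}"
  proof (intro equalityI subsetI)
    fix y assume y: "y \<in> {f a<..<f b}"
    then obtain x where "x \<in> {p..q}" "y = f x" using onto[of y] by auto
    then show "y \<in> f ` {a<..<b}" using y ab by (intro image_eqI[of _ _ x]) (auto simp: less)
  qed (use ab in \<open>auto simp: less\<close>)
qed

lemma strict_mono_on_endpoints:
  fixes f :: "real \<Rightarrow> real"
  assumes "strict_mono_on {a..b} f" "f ` {a..b} = {c..d}" "a \<le> b"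
  shows "f a = c" "f b = d"
proof -
  have "f ` {a..b} = {f a..f b}"
    using assms by (intro strict_mono_on_image_intervals(1)) auto
  then have "{f a..f b} = {c..d}"
    using assms(2) by (rule trans[OF sym])
  moreover have "f a \<le> f b"
    using strict_mono_on_leD[OF assms(1), of a b] assms(3) by simp
  ultimately show "f a = c" "f b = d"
    by (auto simp: Icc_eq_Icc)
qed

lemma strict_mono_on_dense_extension:
  fixes D :: "real set" and f :: "real \<Rightarrow> real"
  assumes D: "D \<subseteq> {0..1}" "\<And>x y. 0 \<le> x \<Longrightarrow> x < y \<Longrightarrow> y \<le> 1 \<Longrightarrow> \<exists>d\<in>D. x < d \<and> d < y"
    and E: "f ` D \<subseteq> {0..1}" "\<And>x y. 0 \<le> x \<Longrightarrow> x < y \<Longrightarrow> y \<le> 1 \<Longrightarrow> \<exists>d\<in>D. x < f d \<and> f d < y"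
    and f: "strict_mono_on D f"
  obtains \<phi> where "strict_mono_on {0..1} \<phi>" "\<phi> ` {0..1} = {0..1}" "\<And>x. x \<in> D \<Longrightarrow> \<phi> x = f x"
proof -
  \<comment> \<open>The inserted \<open>0\<close> keeps the supremum meaningful when no point of
    \<open>D\<close> lies below \<open>x\<close>, as may happen at \<open>x = 0\<close>.\<close>
  define A where "A x = insert 0 (f ` (D \<inter> {..x}))" for x
  define \<phi> where "\<phi> x = Sup (A x)" for x
  have A01: "A x \<subseteq> {0..1}" for x using E(1) by (auto simp: A_def)
  have bdd: "bdd_above (A x)" for x
    using A01 by (rule bdd_above_mono[rotated]) simp
  have upper: "y \<le> \<phi> x" if "y \<in> A x" for x y
    unfolding \<phi>_def using that bdd by (rule cSup_upper)
  have least: "\<phi> x \<le> y" if "\<And>z. z \<in> A x \<Longrightarrow> z \<le> y" for x y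
    unfolding \<phi>_def using that by (intro cSup_least) (auto simp: A_def)
  have range: "\<phi> x \<in> {0..1}" for x
  proof -
    have "0 \<le> \<phi> x" by (intro upper) (simp add: A_def)
    moreover have "\<phi> x \<le> 1" using A01[of x] by (intro least) auto
    ultimately show ?thesis by simp
  qed
  have mono: "\<phi> x \<le> \<phi> y" if "x \<le> y" for x y
    using that by (intro least upper) (auto simp: A_def)
  have ext: "\<phi> d = f d" if d: "d \<in> D" for d
  proof (rule antisym)
    show "f d \<le> \<phi> d" using d by (intro upper) (auto simp: A_def)
    show "\<phi> d \<le> f d"
      using d E(1) by (intro least) (auto simp: A_def strict_mono_on_leD[OF f])
  qed
  have strict: "strict_mono_on {0..1} \<phi>"
  proof (rule strict_mono_onI)
    fix x y :: real assume xy: "x \<in> {0..1}" "y \<in> {0..1}" "x < y"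
    obtain d where d: "d \<in> D" "x < d" "d < y" using D(2)[of x y] xy by auto
    \<comment> \<open>A second point is needed because monotonicity gives only weak inequalities at
      \<open>x\<close> and \<open>y\<close>; the strict one is \<open>f d < f d'\<close>.\<close>
    obtain d' where d': "d' \<in> D" "d < d'" "d' < y" using D(2)[of d y] d xy by auto
    have "\<phi> x \<le> f d" using mono[of x d] d ext by simp
    also have "\<dots> < f d'" using f d d' by (auto dest: strict_mono_onD)
    also have "\<dots> \<le> \<phi> y" using mono[of d' y] d' ext by simp
    finally show "\<phi> x < \<phi> y" .
  qed
  have "y \<in> \<phi> ` {0..1}" if y: "y \<in> {0..1}" for y
  proof -
    \<comment> \<open>The candidate preimage is the supremum of the points that \<open>f\<close>
      sends to at most \<open>y\<close>; a value of \<open>f\<close> strictly between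
      \<open>y\<close> and \<open>\<phi> x\<close> refutes either strict inequality.\<close>
    define B where "B = insert 0 {d \<in> D. f d \<le> y}"
    define x where "x = Sup B"
    have B01: "B \<subseteq> {0..1}" using D(1) by (auto simp: B_def)
    have bddB: "bdd_above B" using B01 by (rule bdd_above_mono[rotated]) simp
    have ne: "B \<noteq> {}" by (simp add: B_def)
    have "0 \<le> x" unfolding x_def using bddB by (intro cSup_upper) (auto simp: B_def)
    moreover have "x \<le> 1" unfolding x_def using ne B01 by (intro cSup_least) auto
    moreover have "\<not> \<phi> x < y"
    proof
      assume "\<phi> x < y"
      then obtain d where d: "d \<in> D" "\<phi> x < f d" "f d < y" using E(2)[of "\<phi> x" y] range[of x] y by auto
      then have "d \<le> x" unfolding x_def using bddB by (intro cSup_upper) (auto simp: B_def)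
      then show False using mono[of d x] d ext by simp
    qed
    moreover have "\<not> y < \<phi> x"
    proof
      assume "y < \<phi> x"
      then obtain d where d: "d \<in> D" "y < f d" "f d < \<phi> x" using E(2)[of y "\<phi> x"] range[of x] y by auto
      then have "d < x" using mono[of x d] ext by (cases "x \<le> d") auto
      then obtain d' where d': "d' \<in> B" "d < d'"
        using less_cSup_iff[OF ne bddB] by (auto simp: x_def)
      moreover have "d \<ge> 0" using d D(1) by auto
      ultimately have "d' \<in> D" "f d' \<le> y" by (auto simp: B_def)
      then show False using strict_mono_onD[OF f, of d d'] d d' by simp
    qed
    ultimately show ?thesis by (intro image_eqI[of _ _ x]) auto
  qed
  then have "\<phi> ` {0..1} = {0..1}" using range by blast
  then show thesis using that strict ext by blast
qed

lemma dense_interval_family_glue: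
  fixes U V :: "(real \<times> real) set" and g :: "real \<times> real \<Rightarrow> real \<Rightarrow> real"
  assumes U: "dense_interval_family U" and V: "dense_interval_family V"
    and \<Phi>: "order_iso_between U (\<prec>) V (\<prec>) \<Phi>"
    and g: "\<And>I. I \<in> U \<Longrightarrow> strict_mono_on {fst I..snd I} (g I)"
      "\<And>I. I \<in> U \<Longrightarrow> g I ` {fst I..snd I} = {fst (\<Phi> I)..snd (\<Phi> I)}"
  obtains \<phi> where "strict_mono_on {0..1} \<phi>" "\<phi> ` {0..1} = {0..1}"
    "\<And>I x. I \<in> U \<Longrightarrow> x \<in> {fst I..snd I} \<Longrightarrow> \<phi> x = g I x"
proof -
  have boundsU: "0 \<le> fst I" "fst I < snd I" "snd I \<le> 1" if "I \<in> U" for I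
    using U that unfolding dense_interval_family_def by blast+
  have boundsV: "0 \<le> fst I" "fst I < snd I" "snd I \<le> 1" if "I \<in> V" for I
    using V that unfolding dense_interval_family_def by blast+
  have cmpU: "I = J \<or> I \<prec> J \<or> J \<prec> I" if "I \<in> U" "J \<in> U" for I J :: "real \<times> real"
    using U that unfolding dense_interval_family_def by blast
  have \<Phi>V: "\<Phi> I \<in> V" if "I \<in> U" for I
    using \<Phi> that by (auto simp: order_iso_between_def bij_betw_def)
  have open_image: "g I ` {fst I<..<snd I} = {fst (\<Phi> I)<..<snd (\<Phi> I)}" if I: "I \<in> U" for I
    using strict_mono_on_image_intervals(2)[OF g[OF I], of "fst I" "snd I"]
      strict_mono_on_endpoints[OF g[OF I]] boundsU[OF I] by simp
  \<comment> \<open>Only open intervals are used, since neighbouring closed ones may share an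
    endpoint, where agreement of the local maps is not yet known.\<close>
  define D where "D = (\<Union>I\<in>U. {fst I<..<snd I})"
  define K where "K x = (SOME I. I \<in> U \<and> x \<in> {fst I<..<snd I})" for x
  define f where "f x = g (K x) x" for x
  have K: "K x \<in> U" "x \<in> {fst (K x)<..<snd (K x)}" if "x \<in> D" for x
    using that someI_ex[of "\<lambda>I. I \<in> U \<and> x \<in> {fst I<..<snd I}"] unfolding K_def D_def by blast+
  have K_eq: "K x = I" if I: "I \<in> U" "x \<in> {fst I<..<snd I}" for I x
  proof -
    have "x \<in> D" using I by (auto simp: D_def)
    then show ?thesis
      using cmpU[OF K(1) I(1), of x] K(2)[of x] I(2) by (auto simp: interval_prec_def)
  qed
  have fD: "f x \<in> {fst (\<Phi> (K x))<..<snd (\<Phi> (K x))}" if "x \<in> D" for x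
    using open_image[OF K(1)[OF that]] K(2)[OF that] unfolding f_def by blast
  obtain \<phi> where \<phi>: "strict_mono_on {0..1} \<phi>" "\<phi> ` {0..1} = {0..1}" "\<And>x. x \<in> D \<Longrightarrow> \<phi> x = f x"
  proof (rule strict_mono_on_dense_extension)
    show "D \<subseteq> {0..1}"
    proof
      fix x assume "x \<in> D"
      then show "x \<in> {0..1}" using K(2)[of x] boundsU[OF K(1)[of x]] by auto
    qed
    show "\<exists>d\<in>D. x < d \<and> d < y" if "0 \<le> x" "x < y" "y \<le> 1" for x y
    proof -
      obtain I z where "I \<in> U" "z \<in> {fst I<..<snd I}" "x < z" "z < y"
        using U \<open>0 \<le> x\<close> \<open>x < y\<close> \<open>y \<le> 1\<close> unfolding dense_interval_family_def by metis
      then show ?thesis unfolding D_def by blast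
    qed
    show "f ` D \<subseteq> {0..1}"
    proof (intro image_subsetI)
      fix x assume "x \<in> D"
      then show "f x \<in> {0..1}" using fD[of x] boundsV[OF \<Phi>V[OF K(1)[of x]]] by auto
    qed
    show "\<exists>d\<in>D. x < f d \<and> f d < y" if "0 \<le> x" "x < y" "y \<le> 1" for x y
    proof -
      obtain J z where J: "J \<in> V" "x < z" "z < y" "z \<in> {fst J<..<snd J}"
        using V \<open>0 \<le> x\<close> \<open>x < y\<close> \<open>y \<le> 1\<close> unfolding dense_interval_family_def by metis
      then obtain I where I: "I \<in> U" "\<Phi> I = J"
        using \<Phi> by (auto simp: order_iso_between_def bij_betw_def)
      then obtain d where d: "d \<in> {fst I<..<snd I}" "g I d = z"
        using open_image[OF I(1)] J(4) by (metis imageE)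
      then have "d \<in> D" "f d = z" using I K_eq[OF I(1) d(1)] by (auto simp: D_def f_def)
      then show ?thesis using J by auto
    qed
    show "strict_mono_on D f"
    proof (rule strict_mono_onI)
      fix x y assume xy: "x \<in> D" "y \<in> D" "x < y"
      note Kx = K[OF xy(1)] and Ky = K[OF xy(2)]
      show "f x < f y"
      proof (cases "K x = K y")
        case True
        then show ?thesis
          unfolding f_def using strict_mono_onD[OF g(1)[OF Kx(1)], of x y] Kx(2) Ky(2) xy by auto
      next
        case False
        then have "K x \<prec> K y"
          using cmpU[OF Kx(1) Ky(1)] Kx(2) Ky(2) xy by (auto simp: interval_prec_def)
        then have "\<Phi> (K x) \<prec> \<Phi> (K y)"
          using \<Phi> Kx(1) Ky(1) by (auto simp: order_iso_between_def)
        then show ?thesis using fD[OF xy(1)] fD[OF xy(2)] by (auto simp: interval_prec_def)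
      qed
    qed
  qed blast
  have "\<phi> x = g I x" if I: "I \<in> U" and x: "x \<in> {fst I..snd I}" for I x
  proof -
    have inner: "\<phi> z = g I z" if "z \<in> {fst I<..<snd I}" for z
      using \<phi>(3)[of z] K_eq[OF I that] that I by (auto simp: D_def f_def)
    \<comment> \<open>Agreement at the endpoints is recovered from the interior: the extension maps
      the open interval onto the same open interval as \<open>g I\<close>, and this determines the
      endpoints.\<close>
    have "{\<phi> (fst I)<..<\<phi> (snd I)} = \<phi> ` {fst I<..<snd I}"
      using strict_mono_on_image_intervals(2)[OF \<phi>(1,2)] boundsU[OF I] by simp
    also have "\<dots> = {fst (\<Phi> I)<..<snd (\<Phi> I)}"
      using inner open_image[OF I] by simp
    finally have "{\<phi> (fst I)<..<\<phi> (snd I)} = {fst (\<Phi> I)<..<snd (\<Phi> I)}" .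
    then have "\<phi> (fst I) = fst (\<Phi> I)" "\<phi> (snd I) = snd (\<Phi> I)"
      using boundsV[OF \<Phi>V[OF I]] by (auto simp: greaterThanLessThan_eq_iff)
    then have "\<phi> (fst I) = g I (fst I)" "\<phi> (snd I) = g I (snd I)"
      using strict_mono_on_endpoints[OF g[OF I]] boundsU[OF I] by auto
    then show ?thesis using inner x by (cases "x = fst I \<or> x = snd I") auto
  qed
  then show thesis using that \<phi> by blast
qed

section \<open>Isomorphic t-norms and their intervals\<close>

lemma tnorm_iso_idempotent_iff:
  assumes S: "continuous_tnorm a b S" and \<phi>: "tnorm_iso a b S c d T \<phi>" and x: "x \<in> {a..b}"
  shows "T (\<phi> x) (\<phi> x) = \<phi> x \<longleftrightarrow> S x x = x"
proof -
  interpret tnorm_interval a b S by unfold_locales fact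
  show ?thesis
    using tnorm_iso_hom[OF \<phi> x x] tnorm_iso_eq_iff[OF \<phi> closed[OF x x] x] by simp
qed

lemma tnorm_iso_restrict:
  assumes \<phi>: "tnorm_iso a b S c d T \<phi>" and "a \<le> p" "p \<le> q" "q \<le> b"
  shows "tnorm_iso p q S (\<phi> p) (\<phi> q) T \<phi>"
proof -
  have "strict_mono_on {p..q} \<phi>"
    using \<phi> assms(2-4) unfolding tnorm_iso_def by (auto intro: monotone_on_subset)
  moreover have "\<phi> ` {p..q} = {\<phi> p..\<phi> q}"
    using \<phi> assms(2-4) unfolding tnorm_iso_def by (metis strict_mono_on_image_intervals(1))
  ultimately show ?thesis
    using \<phi> assms(2-4) unfolding tnorm_iso_def by auto
qed

lemma tnorm_iso_gap:
  assumes S: "continuous_tnorm 0 1 S" and \<phi>: "tnorm_iso 0 1 S 0 1 T \<phi>" and gap: "gap S a b"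
  shows "gap T (\<phi> a) (\<phi> b)"
proof -
  have ab: "a \<in> {0..1}" "b \<in> {0..1}" using gap by (auto simp: gap_def)
  have "T y y \<noteq> y" if y: "\<phi> a < y" "y < \<phi> b" for y
  proof -
    have "y \<in> {0..1}" using y tnorm_iso_mem[OF \<phi> ab(1)] tnorm_iso_mem[OF \<phi> ab(2)] by auto
    then obtain x where x: "x \<in> {0..1}" "\<phi> x = y" using tnorm_iso_onto[OF \<phi>] by blast
    then have "a < x" "x < b"
      using y tnorm_iso_less_iff[OF \<phi>] ab by auto
    then show ?thesis
      using gap tnorm_iso_idempotent_iff[OF S \<phi> x(1)] x(2) by (auto simp: gap_def)
  qed
  then show ?thesis
    using gap tnorm_iso_mem[OF \<phi> ab(1)] tnorm_iso_mem[OF \<phi> ab(2)] tnorm_iso_less_iff[OF \<phi> ab]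
      tnorm_iso_idempotent_iff[OF S \<phi> ab(1)] tnorm_iso_idempotent_iff[OF S \<phi> ab(2)]
    by (auto simp: gap_def)
qed

lemma tnorm_iso_idempotent_interval:
  assumes S: "continuous_tnorm 0 1 S" and \<phi>: "tnorm_iso 0 1 S 0 1 T \<phi>" and ab: "a \<in> {0..1}" "b \<in> {0..1}"
  shows "idempotent_interval T (\<phi> a) (\<phi> b) \<longleftrightarrow> idempotent_interval S a b"
proof -
  have "(\<forall>y\<in>{\<phi> a<..<\<phi> b}. T y y = y) \<longleftrightarrow> (\<forall>x\<in>{a<..<b}. S x x = x)" if "a < b"
  proof -
    have image: "\<phi> ` {a<..<b} = {\<phi> a<..<\<phi> b}"
      using \<phi> ab that unfolding tnorm_iso_def by (intro strict_mono_on_image_intervals(2)) auto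
    show ?thesis
      unfolding image[symmetric] ball_simps
      by (intro ball_cong refl tnorm_iso_idempotent_iff[OF S \<phi>]) (use ab in auto)
  qed
  then show ?thesis
    using tnorm_iso_mem[OF \<phi> ab(1)] tnorm_iso_mem[OF \<phi> ab(2)] tnorm_iso_less_iff[OF \<phi> ab] ab
    unfolding idempotent_interval_def by auto
qed

text \<open>A larger idempotent interval for \<open>T\<close> has endpoints in the range of
  \<open>\<phi>\<close>; its pullback is an idempotent interval for \<open>S\<close>, so maximality
  of \<open>(a, b)\<close> applies.\<close>

lemma tnorm_iso_Minimum:
  assumes S: "continuous_tnorm 0 1 S" and \<phi>: "tnorm_iso 0 1 S 0 1 T \<phi>"
    and M: "(a, b) \<in> intervals_of_kind Minimum S"
  shows "(\<phi> a, \<phi> b) \<in> intervals_of_kind Minimum T"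
proof -
  have ab: "a \<in> {0..1}" "b \<in> {0..1}" "a < b" "idempotent_interval S a b"
    using M by (auto simp: idempotent_interval_def)
  have "{c<..<d} = {\<phi> a<..<\<phi> b}"
    if cd: "idempotent_interval T c d" "{\<phi> a<..<\<phi> b} \<subseteq> {c<..<d}" for c d
  proof -
    have "c \<in> {0..1}" "d \<in> {0..1}" using cd by (auto simp: idempotent_interval_def)
    then obtain c' d' where c'd': "c' \<in> {0..1}" "d' \<in> {0..1}" "c = \<phi> c'" "d = \<phi> d'"
      using tnorm_iso_onto[OF \<phi>] by metis
    have "c \<le> \<phi> a" "\<phi> b \<le> d"
      using cd(2) tnorm_iso_less_iff[OF \<phi> ab(1,2)] ab(3)
      by (auto simp: greaterThanLessThan_subseteq_greaterThanLessThan)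
    then have "{a<..<b} \<subseteq> {c'<..<d'}"
      using c'd' ab tnorm_iso_le_iff[OF \<phi>] by (auto simp: greaterThanLessThan_subseteq_greaterThanLessThan)
    moreover have "idempotent_interval S c' d'"
      using cd(1) c'd' tnorm_iso_idempotent_interval[OF S \<phi>] by simp
    ultimately have "{c'<..<d'} = {a<..<b}" using M by simp
    then have "c' = a" "d' = b" using ab by (auto simp: greaterThanLessThan_eq_iff)
    then show ?thesis using c'd' by simp
  qed
  then show ?thesis
    using tnorm_iso_idempotent_interval[OF S \<phi> ab(1,2)] ab(4) by simp
qed

text \<open>For a gap, the inverse of the restricted \<open>\<phi>\<close> followed by the given
  isomorphism to the model identifies the image with the same model.\<close>

lemma tnorm_iso_kind:
  assumes S: "continuous_tnorm 0 1 S" and T: "continuous_tnorm 0 1 T" and \<phi>: "tnorm_iso 0 1 S 0 1 T \<phi>"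
    and I: "(a, b) \<in> intervals_of_kind i S"
  shows "(\<phi> a, \<phi> b) \<in> intervals_of_kind i T"
proof (cases "i = Minimum")
  case True
  then show ?thesis using tnorm_iso_Minimum[OF S \<phi>] I by simp
next
  case False
  then have gap: "gap S a b" using I kind_gap by blast
  interpret T: tnorm_interval 0 1 T by unfold_locales fact
  interpret S: tnorm_interval 0 1 S by unfold_locales fact
  have gap': "gap T (\<phi> a) (\<phi> b)" by (rule tnorm_iso_gap[OF S \<phi> gap])
  have "continuous_tnorm (\<phi> a) (\<phi> b) T"
    using gap' by (intro T.restrict) (auto simp: gap_def)
  moreover have "continuous_tnorm a b S"
    using gap by (intro S.restrict) (auto simp: gap_def)
  moreover have "tnorm_iso a b S (\<phi> a) (\<phi> b) T \<phi>"
    using gap by (intro tnorm_iso_restrict[OF \<phi>]) (auto simp: gap_def)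
  ultimately have "tnorm_isomorphic a b S (\<phi> a) (\<phi> b) T"
    by (auto simp: tnorm_isomorphic_iff)
  then have "tnorm_isomorphic (\<phi> a) (\<phi> b) T a b S"
    by (rule tnorm_isomorphic_sym)
  then show ?thesis
    using I gap' False
    by (cases i) (simp_all add: component_iff_gap, (blast intro: tnorm_isomorphic_trans)+)
qed

text \<open>\<open>tnorm_iso_kind\<close>, applied to \<open>\<phi>\<close> and to its inverse,
  yields both the bijection and the equivalence of kinds.\<close>

lemma isomorphic_imp_Upsilon_iso:
  assumes S: "continuous_tnorm 0 1 S" and T: "continuous_tnorm 0 1 T" and \<phi>: "tnorm_iso 0 1 S 0 1 T \<phi>"
  defines "\<Phi> \<equiv> map_prod \<phi> \<phi>"
  shows "order_iso_between (Upsilon S) (\<prec>) (Upsilon T) (\<prec>) \<Phi>"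
    and "(a, b) \<in> Upsilon S \<Longrightarrow> (a, b) \<in> intervals_of_kind i S \<longleftrightarrow> \<Phi> (a, b) \<in> intervals_of_kind i T"
proof -
  define \<psi> where "\<psi> = inv_into {0..1} \<phi>"
  have \<psi>: "tnorm_iso 0 1 T 0 1 S \<psi>"
    unfolding \<psi>_def by (rule tnorm_iso_inverse[OF S \<phi>])
  have inj: "inj_on \<phi> {0..1}" and onto: "\<phi> ` {0..1} = {0..1}"
    using \<phi> by (auto simp: tnorm_iso_def strict_mono_on_imp_inj_on)
  have inv: "\<psi> (\<phi> x) = x" "\<phi> (\<psi> x) = x" if "x \<in> {0..1}" for x
    using that inv_into_f_f[OF inj that] f_inv_into_f[of x \<phi> "{0..1}"] onto by (auto simp: \<psi>_def)
  have bounds: "a \<in> {0..1}" "b \<in> {0..1}" if "continuous_tnorm 0 1 U" "(a, b) \<in> Upsilon U" for a b U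
    using that by (auto simp: Upsilon_iff gap_def idempotent_interval_def)
  show kind: "(a, b) \<in> intervals_of_kind i S \<longleftrightarrow> \<Phi> (a, b) \<in> intervals_of_kind i T"
    if "(a, b) \<in> Upsilon S" for a b i
    using tnorm_iso_kind[OF S T \<phi>, of a b i] tnorm_iso_kind[OF T S \<psi>, of "\<phi> a" "\<phi> b" i]
      inv(1)[OF bounds(1)[OF S that]] inv(1)[OF bounds(2)[OF S that]]
    by (auto simp: \<Phi>_def)
  have "bij_betw \<Phi> (Upsilon S) (Upsilon T)"
  proof (rule bij_betw_byWitness[where f' = "map_prod \<psi> \<psi>"])
    show "\<forall>I\<in>Upsilon S. map_prod \<psi> \<psi> (\<Phi> I) = I"
      using bounds[OF S] inv by (auto simp: \<Phi>_def simp del: atLeastAtMost_iff)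
    show "\<forall>I\<in>Upsilon T. \<Phi> (map_prod \<psi> \<psi> I) = I"
      using bounds[OF T] inv by (auto simp: \<Phi>_def simp del: atLeastAtMost_iff)
    show "\<Phi> ` Upsilon S \<subseteq> Upsilon T"
      using Upsilon_kind[of _ S] tnorm_iso_kind[OF S T \<phi>] intervals_of_kind_subset_Upsilon[of _ T]
      by (fastforce simp: \<Phi>_def)
    show "map_prod \<psi> \<psi> ` Upsilon T \<subseteq> Upsilon S"
      using Upsilon_kind[of _ T] tnorm_iso_kind[OF T S \<psi>] intervals_of_kind_subset_Upsilon[of _ S]
      by fastforce
  qed
  moreover have "I \<prec> J \<longleftrightarrow> \<Phi> I \<prec> \<Phi> J" if "I \<in> Upsilon S" "J \<in> Upsilon S" for I J
    using that tnorm_iso_le_iff[OF \<phi>, of "snd I" "fst J"] bounds(2)[OF S, of "fst I" "snd I"]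
      bounds(1)[OF S, of "fst J" "snd J"]
    by (simp add: interval_prec_def \<Phi>_def)
  ultimately show "order_iso_between (Upsilon S) (\<prec>) (Upsilon T) (\<prec>) \<Phi>"
    by (auto simp: order_iso_between_def)
qed

text \<open>Two copies of one model are isomorphic through it. On intervals of idempotents an affine
  map is taken, since only the order matters there: products are settled by
  \<open>idem_between\<close>.\<close>

lemma same_kind_iso:
  assumes I: "(a, b) \<in> intervals_of_kind i S" and J: "(c, d) \<in> intervals_of_kind i T"
  obtains g where "strict_mono_on {a..b} g" "g ` {a..b} = {c..d}"
    "i \<noteq> Minimum \<Longrightarrow> tnorm_iso a b S c d T g"
proof (cases "i = Minimum")
  case True
  then have ab: "a < b" "c < d" using I J by (auto simp: idempotent_interval_def)
  define m where "m = (d - c) / (b - a)"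
  define g where "g x = m * x + (c - m * a)" for x
  have m: "m > 0" using ab by (simp add: m_def)
  have "strict_mono_on {a..b} g"
    using m by (auto intro!: strict_mono_onI simp: g_def)
  moreover have "m * b + (c - m * a) = d"
  proof -
    have "m * (b - a) = d - c" using ab by (simp add: m_def)
    then show ?thesis by (simp add: algebra_simps)
  qed
  then have "g ` {a..b} = {c..d}"
    using image_affinity_atLeastAtMost[of m "c - m * a" a b] m ab by (simp add: g_def[abs_def])
  ultimately show thesis using that True by blast
next
  case False
  have "tnorm_isomorphic a b S c d T"
    using I J False by (cases i) (simp_all, (blast intro: tnorm_isomorphic_trans tnorm_isomorphic_sym)+)
  then obtain g where "tnorm_iso a b S c d T g" by (auto simp: tnorm_isomorphic_iff)
  then show thesis using that by (auto simp: tnorm_iso_def)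
qed

lemma Upsilon_iso_imp_isomorphic:
  assumes S: "continuous_tnorm 0 1 S" and T: "continuous_tnorm 0 1 T"
    and \<Phi>: "order_iso_between (Upsilon S) (\<prec>) (Upsilon T) (\<prec>) \<Phi>"
    and kind: "\<And>I i. I \<in> intervals_of_kind i S \<Longrightarrow> \<Phi> I \<in> intervals_of_kind i T"
  shows "tnorm_isomorphic 0 1 S 0 1 T"
proof -
  interpret S: tnorm_interval 0 1 S by unfold_locales fact
  interpret T: tnorm_interval 0 1 T by unfold_locales fact
  have "\<forall>I\<in>Upsilon S. \<exists>g. strict_mono_on {fst I..snd I} g \<and>
      g ` {fst I..snd I} = {fst (\<Phi> I)..snd (\<Phi> I)} \<and>
      (gap S (fst I) (snd I) \<longrightarrow> tnorm_iso (fst I) (snd I) S (fst (\<Phi> I)) (snd (\<Phi> I)) T g)"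
  proof
    fix I assume I: "I \<in> Upsilon S"
    \<comment> \<open>For a gap the kind is chosen among the two Archimedean ones, so that
      \<open>same_kind_iso\<close> returns a t-norm isomorphism and not merely an order
      isomorphism.\<close>
    have "\<exists>i. I \<in> intervals_of_kind i S \<and> (gap S (fst I) (snd I) \<longrightarrow> i \<noteq> Minimum)"
    proof (cases "gap S (fst I) (snd I)")
      case True
      then have "I \<in> intervals_of_kind Product S \<or> I \<in> intervals_of_kind Lukasiewicz S"
        using gap_kind[OF S True] by (simp del: intervals_of_kind.simps)
      then show ?thesis by blast
    next
      case False
      then show ?thesis using Upsilon_kind[OF I] by blast
    qed
    then obtain i where i: "I \<in> intervals_of_kind i S" "gap S (fst I) (snd I) \<longrightarrow> i \<noteq> Minimum"
      by blast
    then have "(fst I, snd I) \<in> intervals_of_kind i S" "(fst (\<Phi> I), snd (\<Phi> I)) \<in> intervals_of_kind i T"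
      using kind by (auto simp del: intervals_of_kind.simps)
    then show "\<exists>g. strict_mono_on {fst I..snd I} g \<and>
      g ` {fst I..snd I} = {fst (\<Phi> I)..snd (\<Phi> I)} \<and>
      (gap S (fst I) (snd I) \<longrightarrow> tnorm_iso (fst I) (snd I) S (fst (\<Phi> I)) (snd (\<Phi> I)) T g)"
      using i(2) by (metis same_kind_iso)
  qed
  then obtain g where g: "\<And>I. I \<in> Upsilon S \<Longrightarrow> strict_mono_on {fst I..snd I} (g I)"
    "\<And>I. I \<in> Upsilon S \<Longrightarrow> g I ` {fst I..snd I} = {fst (\<Phi> I)..snd (\<Phi> I)}"
    "\<And>I. I \<in> Upsilon S \<Longrightarrow> gap S (fst I) (snd I) \<Longrightarrow>
        tnorm_iso (fst I) (snd I) S (fst (\<Phi> I)) (snd (\<Phi> I)) T (g I)"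
    by metis
  obtain \<phi> where \<phi>: "strict_mono_on {0..1} \<phi>" "\<phi> ` {0..1} = {0..1}"
    "\<And>I x. I \<in> Upsilon S \<Longrightarrow> x \<in> {fst I..snd I} \<Longrightarrow> \<phi> x = g I x"
    using dense_interval_family_glue[OF dense_interval_family_Upsilon[OF S] dense_interval_family_Upsilon[OF T] \<Phi> g(1,2)]
    by blast
  have mem: "\<phi> x \<in> {0..1}" if "x \<in> {0..1}" for x using \<phi>(2) that by blast
  have le: "\<phi> x \<le> \<phi> y" if "x \<in> {0..1}" "y \<in> {0..1}" "x \<le> y" for x y
    using strict_mono_on_leD[OF \<phi>(1) that] .
  \<comment> \<open>A non-idempotent value would lie in a gap of \<open>T\<close>. The interval that
    \<open>\<Phi>\<close> sends to this gap is not of kind \<open>Minimum\<close>, so it is a gap of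
    \<open>S\<close>, and it would contain the idempotent \<open>e\<close>.\<close>
  have idem: "T (\<phi> e) (\<phi> e) = \<phi> e" if e: "e \<in> {0..1}" "S e e = e" for e
  proof (rule ccontr)
    assume "T (\<phi> e) (\<phi> e) \<noteq> \<phi> e"
    then obtain c d where cd: "gap T c d" "c < \<phi> e" "\<phi> e < d"
      using non_idempotent_in_gap[OF T mem[OF e(1)]] by blast
    then have "(c, d) \<in> Upsilon T" using Upsilon_iff[OF T] by blast
    then obtain a b where ab: "(a, b) \<in> Upsilon S" "\<Phi> (a, b) = (c, d)"
      using \<Phi> by (force simp: order_iso_between_def bij_betw_def)
    have "(a, b) \<notin> intervals_of_kind Minimum S"
    proof
      assume "(a, b) \<in> intervals_of_kind Minimum S"
      from kind[OF this] have "idempotent_interval T c d" using ab(2) by simp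
      then have "T (\<phi> e) (\<phi> e) = \<phi> e" using cd by (auto simp: idempotent_interval_def)
      then show False using cd by (auto simp: gap_def)
    qed
    then have gap: "gap S a b" using ab(1) Upsilon_iff[OF S] by blast
    have "\<phi> e \<in> g (a, b) ` {a..b}" using g(2)[OF ab(1)] ab(2) cd by simp
    then obtain x where x: "x \<in> {a..b}" "\<phi> x = \<phi> e"
      using \<phi>(3)[OF ab(1)] by force
    have "x \<in> {0..1}" using x gap by (auto simp: gap_def)
    then have "x = e" using strict_mono_on_eq[OF \<phi>(1), of x e] x e by simp
    moreover have "\<phi> a = c" "\<phi> b = d"
      using strict_mono_on_endpoints[OF g(1,2)[OF ab(1)]] \<phi>(3)[OF ab(1)] gap ab(2) by (auto simp: gap_def)
    ultimately have "a < e" "e < b" using x cd by (auto simp: less_le)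
    then show False using gap e by (auto simp: gap_def)
  qed
  have hom: "\<phi> (S x y) = T (\<phi> x) (\<phi> y)" if xy: "x \<in> {0..1}" "y \<in> {0..1}" "x \<le> y" for x y
  proof (cases "\<exists>e. x \<le> e \<and> e \<le> y \<and> S e e = e")
    case True
    then obtain e where e: "x \<le> e" "e \<le> y" "S e e = e" by blast
    then have e01: "e \<in> {0..1}" using xy by auto
    have "S x y = x" using S.idem_between[of e x y] e xy by auto
    moreover have "T (\<phi> x) (\<phi> y) = \<phi> x"
      using T.idem_between[OF idem[OF e01 e(3)], of "\<phi> x" "\<phi> y"] le[OF xy(1) e01 e(1)] le[OF e01 xy(2) e(2)]
        mem[OF xy(1)] mem[OF xy(2)] by auto
    ultimately show ?thesis by simp
  next
    case False
    then have "S x x \<noteq> x" using xy by auto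
    then obtain a b where ab: "gap S a b" "a < x" "x < b"
      using non_idempotent_in_gap[OF S xy(1)] by blast
    have "S b b = b" using ab by (simp add: gap_def)
    \<comment> \<open>Otherwise the idempotent \<open>b\<close> would separate \<open>x\<close> from
      \<open>y\<close>; thus both points lie in the gap, where \<open>\<phi>\<close> is the local
      isomorphism.\<close>
    then have "y < b" using False ab by (meson less_imp_le not_le)
    then have xy': "x \<in> {a..b}" "y \<in> {a..b}" using ab xy by auto
    have U: "(a, b) \<in> Upsilon S" using ab Upsilon_iff[OF S] by blast
    have "continuous_tnorm a b S"
      using ab by (intro S.restrict) (auto simp: gap_def)
    then interpret ab: tnorm_interval a b S by unfold_locales
    have "\<phi> z = g (a, b) z" if "z \<in> {a..b}" for z using \<phi>(3)[OF U] that by simp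
    then show ?thesis
      using tnorm_iso_hom[OF g(3)[OF U]] ab(1) xy' ab.closed[OF xy'] by simp
  qed
  have "\<phi> (S x y) = T (\<phi> x) (\<phi> y)" if xy: "x \<in> {0..1}" "y \<in> {0..1}" for x y
    using hom[OF xy] hom[OF xy(2,1)] S.comm[OF xy] T.comm[OF mem[OF xy(1)] mem[OF xy(2)]] by fastforce
  then have "tnorm_iso 0 1 S 0 1 T \<phi>"
    using \<phi>(1,2) by (simp add: tnorm_iso_def)
  then show ?thesis using S T by (auto simp: tnorm_isomorphic_iff)
qed

theorem theorem2p6:
  fixes S T :: "real \<Rightarrow> real \<Rightarrow> real"
  assumes "continuous_tnorm 0 1 S" and "continuous_tnorm 0 1 T"
  shows "tnorm_isomorphic 0 1 S 0 1 T \<longleftrightarrow>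
    (\<exists>\<Phi>. order_iso_between (Upsilon S) (\<prec>) (Upsilon T) (\<prec>) \<Phi> \<and>
         (\<forall>(a, b)\<in>Upsilon S. \<forall>i.
            (a, b) \<in> intervals_of_kind i S \<longleftrightarrow> \<Phi> (a, b) \<in> intervals_of_kind i T))"
proof
  assume "tnorm_isomorphic 0 1 S 0 1 T"
  then obtain \<phi> where "tnorm_iso 0 1 S 0 1 T \<phi>" by (auto simp: tnorm_isomorphic_iff)
  from isomorphic_imp_Upsilon_iso[OF assms this]
  show "\<exists>\<Phi>. order_iso_between (Upsilon S) (\<prec>) (Upsilon T) (\<prec>) \<Phi> \<and>
         (\<forall>(a, b)\<in>Upsilon S. \<forall>i.
            (a, b) \<in> intervals_of_kind i S \<longleftrightarrow> \<Phi> (a, b) \<in> intervals_of_kind i T)"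
    by blast
next
  assume "\<exists>\<Phi>. order_iso_between (Upsilon S) (\<prec>) (Upsilon T) (\<prec>) \<Phi> \<and>
         (\<forall>(a, b)\<in>Upsilon S. \<forall>i.
            (a, b) \<in> intervals_of_kind i S \<longleftrightarrow> \<Phi> (a, b) \<in> intervals_of_kind i T)"
  then obtain \<Phi> where \<Phi>: "order_iso_between (Upsilon S) (\<prec>) (Upsilon T) (\<prec>) \<Phi>"
    and kind: "\<And>a b i. (a, b) \<in> Upsilon S \<Longrightarrow>
      (a, b) \<in> intervals_of_kind i S \<longleftrightarrow> \<Phi> (a, b) \<in> intervals_of_kind i T"
    by blast
  have "\<Phi> I \<in> intervals_of_kind i T" if "I \<in> intervals_of_kind i S" for I i
  proof -
    have "I \<in> Upsilon S" using that intervals_of_kind_subset_Upsilon by blast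
    then show ?thesis using kind[of "fst I" "snd I" i] that by simp
  qed
  with assms \<Phi> show "tnorm_isomorphic 0 1 S 0 1 T"
    by (rule Upsilon_iso_imp_isomorphic)
qed

end
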